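(* Let $p$ be an odd prime, let $G$ be a quasi-powerful $p$-group and let $x,y\in G$. Then $o([x,y])\le o(y)$.
   Context: For an odd prime $p$, a finite $p$-group $G$ is powerful if $[G,G]\le G^{p}$, and $G$ is quasi-powerful if $G/Z(G)$ is powerful. $o(g)$ denotes the order of $g$; $[x,y]=x^{-1}y^{-1}xy$. *)

theory Defs
  imports "HOL-Algebra.Algebra"
begin

definition group_center :: "('a, 'b) monoid_scheme \<Rightarrow> 'a set" where
  "group_center G = {z \<in> carrier G. \<forall>g \<in> carrier G. z \<otimes>\<^bsub>G\<^esub> g = g \<otimes>\<^bsub>G\<^esub> z}"

definition commutator :: "('a, 'b) monoid_scheme \<Rightarrow> 'a \<Rightarrow> 'a \<Rightarrow> 'a" where
  "commutator G x y = inv\<^bsub>G\<^esub> x \<otimes>\<^bsub>G\<^esub> inv\<^bsub>G\<^esub> y \<otimes>\<^bsub>G\<^esub> x \<otimes>\<^bsub>G\<^esub> y"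

definition pth_powers_subgroup :: "('a, 'b) monoid_scheme \<Rightarrow> nat \<Rightarrow> 'a set" where
  "pth_powers_subgroup G p = generate G {g [^]\<^bsub>G\<^esub> p | g. g \<in> carrier G}"

definition powerful :: "nat \<Rightarrow> ('a, 'b) monoid_scheme \<Rightarrow> bool" where
  "powerful p G \<longleftrightarrow> derived G (carrier G) \<subseteq> pth_powers_subgroup G p"

definition p_group :: "nat \<Rightarrow> ('a, 'b) monoid_scheme \<Rightarrow> bool" where
  "p_group p G \<longleftrightarrow> group G \<and> finite (carrier G) \<and> (\<exists>n. order G = p ^ n)"

definition quasi_powerful :: "nat \<Rightarrow> ('a, 'b) monoid_scheme \<Rightarrow> bool" where
  "quasi_powerful p G \<longleftrightarrow> powerful p (G Mod group_center G)"

end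

theory Submission
  imports Defs
begin

text \<open>
  A quasi-powerful group \<open>G\<close> embeds in a powerful one: adjoining central \<open>p\<close>-th roots of all central
  elements gives \<open>H = \<phi>(G) Z(H)\<close> with \<open>[H, H] = \<phi>([G, G]) \<le> \<phi>(G\<^sup>p Z(G)) \<le> H\<^sup>p\<close>. So let \<open>G\<close> be
  powerful.

  If the elements of order dividing \<open>p\<close> are closed under products, they form a normal subgroup \<open>\<Omega>\<close>
  of exponent \<open>p\<close>; passing to \<open>G / \<Omega>\<close>, induction on \<open>k\<close> shows that \<open>y ^ (p ^ k) = 1\<close> implies
  \<open>[x, y] ^ (p ^ k) = 1\<close>.

  Closure under products is proved by induction on \<open>|G|\<close>. The subgroup \<open>M\<close> generated by \<open>x\<close> and
  \<open>G\<^sup>p\<close> is normal, powerful and, unless \<open>G\<close> is abelian, proper, so the elements of order dividing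
  \<open>p\<close> in \<open>M\<close> form a normal subgroup of \<open>G\<close> that contains many commutators.
  Longer commutators lie deeper in the series \<open>G, G\<^sup>p, (G\<^sup>p)\<^sup>p, \<dots>\<close> and hence are \<open>p ^ i\<close>-th
  powers, which commute with elements of small order. Thus only the class two formula
  \<open>(x u)\<^sup>n = x\<^sup>n u\<^sup>n t ^ (n choose 2)\<close> with \<open>t = [u, x]\<close> is ever needed.
\<close>

section \<open>Commutators and subgroups of p-th powers\<close>

text \<open>This is the subgroup often written H^p. The ambient group stays \<open>G\<close> while
  \<open>H\<close> varies, so that iteration gives the series G, G^p, (G^p)^p; on
  \<open>carrier G\<close> it agrees with \<open>pth_powers_subgroup\<close>.\<close>

definition agemo :: "nat \<Rightarrow> ('a, 'b) monoid_scheme \<Rightarrow> 'a set \<Rightarrow> 'a set" where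
  "agemo p G H = generate G ((\<lambda>g. g [^]\<^bsub>G\<^esub> p) ` H)"

context group
begin

section \<open>Commutator identities and the class two power formula\<close>

lemma commutator_closed [simp, intro]:
  "x \<in> carrier G \<Longrightarrow> y \<in> carrier G \<Longrightarrow> commutator G x y \<in> carrier G"
  by (simp add: commutator_def)

lemma commutator_alt:
  "x \<in> carrier G \<Longrightarrow> y \<in> carrier G \<Longrightarrow> commutator G x y = inv (y \<otimes> x) \<otimes> (x \<otimes> y)"
  by (simp add: commutator_def m_assoc inv_mult_group)

lemma mult_eq_commutator:
  assumes "x \<in> carrier G" "y \<in> carrier G"
  shows "x \<otimes> y = y \<otimes> x \<otimes> commutator G x y"
  using assms by (simp add: commutator_alt flip: m_assoc)

lemma commutator_eq_one_iff:
  assumes "x \<in> carrier G" "y \<in> carrier G"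
  shows "commutator G x y = \<one> \<longleftrightarrow> x \<otimes> y = y \<otimes> x"
proof -
  have "commutator G x y = \<one> \<longleftrightarrow> \<one> = inv (y \<otimes> x) \<otimes> (x \<otimes> y)"
    using assms by (auto simp: commutator_alt)
  also have "\<dots> \<longleftrightarrow> x \<otimes> y = y \<otimes> x"
    using assms by (subst inv_solve_left) auto
  finally show ?thesis .
qed

lemma conj_eq_commutator:
  assumes "x \<in> carrier G" "y \<in> carrier G"
  shows "inv y \<otimes> x \<otimes> y = x \<otimes> commutator G x y"
  using assms by (simp add: commutator_def flip: m_assoc)

lemma commutator_eq_conj:
  assumes "x \<in> carrier G" "y \<in> carrier G"
  shows "commutator G x y = inv x \<otimes> (inv y \<otimes> x \<otimes> y)"
  using assms by (simp add: commutator_def m_assoc)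

lemma commutator_swap:
  assumes "x \<in> carrier G" "y \<in> carrier G"
  shows "commutator G y x = inv (commutator G x y)"
  using assms by (simp add: commutator_def m_assoc inv_mult_group)

lemma commute_pow:
  assumes "x \<in> carrier G" "y \<in> carrier G" "x \<otimes> y = y \<otimes> x"
  shows "x [^] (n::nat) \<otimes> y = y \<otimes> x [^] n"
  using assms by (metis group_commutes_pow)

text \<open>Moving \<open>x\<close> to the left past \<open>u [^] k\<close> releases
  \<open>k\<close> copies of \<open>t\<close>, which commute with \<open>x\<close> and
  \<open>u\<close>. Over all factors this adds up to 0 + 1 + ... + (n - 1) copies.\<close>

lemma pow_mult_class2:
  assumes c: "x \<in> carrier G" "u \<in> carrier G" "t \<in> carrier G"
    and ux: "u \<otimes> x = x \<otimes> u \<otimes> t" and tx: "t \<otimes> x = x \<otimes> t" and tu: "t \<otimes> u = u \<otimes> t"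
  shows "(x \<otimes> u) [^] n = x [^] n \<otimes> u [^] n \<otimes> t [^] (n choose 2)"
proof (induction n)
  case 0
  then show ?case using c by (simp add: numeral_2_eq_2)
next
  case (Suc n)
  have up: "u [^] k \<otimes> x = x \<otimes> u [^] k \<otimes> t [^] k" for k :: nat
  proof (induction k)
    case 0
    then show ?case using c by simp
  next
    case (Suc k)
    have "u [^] Suc k \<otimes> x = u [^] k \<otimes> (x \<otimes> u \<otimes> t)"
      using c ux by (simp add: m_assoc)
    also have "\<dots> = (u [^] k \<otimes> x) \<otimes> u \<otimes> t"
      using c by (simp add: m_assoc)
    also have "\<dots> = x \<otimes> u [^] k \<otimes> (t [^] k \<otimes> u) \<otimes> t"
      using c Suc by (simp add: m_assoc)
    also have "t [^] k \<otimes> u = u \<otimes> t [^] k"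
      using c tu commute_pow by blast
    finally show ?case using c by (simp add: m_assoc)
  qed
  have tk: "t [^] k \<otimes> x = x \<otimes> t [^] k" "t [^] k \<otimes> u = u \<otimes> t [^] k" for k :: nat
    using c tx tu commute_pow by blast+
  have "(x \<otimes> u) [^] Suc n = x [^] n \<otimes> u [^] n \<otimes> (t [^] (n choose 2) \<otimes> x) \<otimes> u"
    using c Suc by (simp add: m_assoc)
  also have "\<dots> = x [^] n \<otimes> (u [^] n \<otimes> x) \<otimes> (t [^] (n choose 2) \<otimes> u)"
    using c tk by (simp add: m_assoc)
  also have "\<dots> = x [^] n \<otimes> x \<otimes> u [^] n \<otimes> (t [^] n \<otimes> u) \<otimes> t [^] (n choose 2)"
    using c by (simp add: m_assoc up tk(2)[of "n choose 2"])
  also have "\<dots> = x [^] Suc n \<otimes> u [^] Suc n \<otimes> (t [^] n \<otimes> t [^] (n choose 2))"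
    using c by (simp add: m_assoc tk(2))
  also have "t [^] n \<otimes> t [^] (n choose 2) = t [^] (Suc n choose 2)"
    using c by (simp add: nat_pow_mult numeral_2_eq_2)
  finally show ?case .
qed

text \<open>For odd \<open>p\<close> the number (p - 1) / 2 is an integer, so \<open>p\<close>
  divides \<open>p choose 2\<close>. This is how the oddness of \<open>p\<close> enters the
  argument.\<close>

lemma pow_odd_choose_two:
  assumes "t \<in> carrier G" "t [^] p = \<one>" "odd (p::nat)"
  shows "t [^] (p choose 2) = \<one>"
proof -
  have "p choose 2 = p * ((p - 1) div 2)"
    using assms(3) by (auto simp: choose_two elim!: oddE)
  then show ?thesis using assms by (simp flip: nat_pow_pow)
qed

text \<open>Conjugation by \<open>y\<close> sends \<open>x\<close> to \<open>x \<otimes> u\<close>,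
  hence \<open>x [^] p\<close> to \<open>(x \<otimes> u) [^] p\<close>. By the class two formula the
  latter is \<open>x [^] p\<close> again, as \<open>u\<close> and \<open>t\<close> are killed by
  \<open>p\<close>.\<close>

lemma commute_pow_of_class2:
  assumes c: "x \<in> carrier G" "y \<in> carrier G" and p: "odd (p::nat)"
    and u: "u = commutator G x y" and t: "t = commutator G u x"
    and tx: "t \<otimes> x = x \<otimes> t" and tu: "t \<otimes> u = u \<otimes> t"
    and up: "u [^] p = \<one>" and tp: "t [^] p = \<one>"
  shows "x [^] p \<otimes> y = y \<otimes> x [^] p"
proof -
  have uc: "u \<in> carrier G" "t \<in> carrier G" using c u t by auto
  have "u \<otimes> x = x \<otimes> u \<otimes> t" using mult_eq_commutator uc c t by blast
  from pow_mult_class2[OF c(1) uc this tx tu, of p]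
  have xu: "(x \<otimes> u) [^] p = x [^] p"
    using c uc up pow_odd_choose_two[OF uc(2) tp p] by simp
  have y: "x \<otimes> y = y \<otimes> (x \<otimes> u)"
    using mult_eq_commutator[OF c] u c uc by (simp add: m_assoc)
  have "x [^] n \<otimes> y = y \<otimes> (x \<otimes> u) [^] n" for n :: nat
  proof (induction n)
    case (Suc n)
    have "x [^] Suc n \<otimes> y = x [^] n \<otimes> y \<otimes> (x \<otimes> u)"
      using c uc y by (simp add: m_assoc)
    then show ?case using c uc Suc by (simp add: m_assoc)
  qed (use c in simp)
  with xu show ?thesis by simp
qed

section \<open>Subgroups of p-th powers, normality and centralizers\<close>

lemma agemo_subgroup: "H \<subseteq> carrier G \<Longrightarrow> subgroup (agemo p G H) G"
  unfolding agemo_def by (rule generate_is_subgroup) auto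

lemma agemo_pow: "h \<in> H \<Longrightarrow> h [^] p \<in> agemo p G H"
  unfolding agemo_def by (auto intro: generate.incl)

lemma agemo_least: "subgroup K G \<Longrightarrow> (\<And>h. h \<in> H \<Longrightarrow> h [^] p \<in> K) \<Longrightarrow> agemo p G H \<subseteq> K"
  unfolding agemo_def by (rule generate_subgroup_incl) auto

lemma agemo_mono: "H \<subseteq> K \<Longrightarrow> agemo p G H \<subseteq> agemo p G K"
  unfolding agemo_def by (rule mono_generate) auto

lemma subgroup_nat_pow_closed:
  assumes "subgroup H G" "h \<in> H" shows "h [^] (n::nat) \<in> H"
  using assms by (induction n) (auto simp: subgroup.one_closed subgroup.m_closed)

lemma agemo_consistent:
  assumes "K \<subseteq> H" "subgroup H G"
  shows "agemo p (G\<lparr>carrier := H\<rparr>) K = agemo p G K"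
proof -
  have "(\<lambda>g. g [^] p) ` K \<subseteq> H"
    using assms subgroup_nat_pow_closed by blast
  then show ?thesis unfolding agemo_def
    by (simp add: generate_consistent[OF _ assms(2)] flip: nat_pow_consistent)
qed

lemma conj_pow:
  assumes "x \<in> carrier G" "g \<in> carrier G"
  shows "(g \<otimes> x \<otimes> inv g) [^] (n::nat) = g \<otimes> x [^] n \<otimes> inv g"
proof (induction n)
  case (Suc n)
  have "(g \<otimes> x \<otimes> inv g) [^] Suc n = g \<otimes> x [^] n \<otimes> (inv g \<otimes> g) \<otimes> x \<otimes> inv g"
    using assms Suc by (simp only: nat_pow_Suc m_assoc m_closed inv_closed nat_pow_closed)
  then show ?case using assms by (simp add: m_assoc)
qed (use assms in simp)

lemma agemo_normal:
  assumes "N \<lhd> G" shows "agemo p G N \<lhd> G"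
  unfolding agemo_def
proof (rule normal_generateI)
  have N: "N \<subseteq> carrier G" using assms by (simp add: normal_imp_subgroup subgroup.subset)
  then show "(\<lambda>g. g [^] p) ` N \<subseteq> carrier G" by auto
  fix h g assume "h \<in> (\<lambda>g. g [^] p) ` N" and g: "g \<in> carrier G"
  then obtain n where n: "n \<in> N" "h = n [^] p" by auto
  then have "g \<otimes> h \<otimes> inv g = (g \<otimes> n \<otimes> inv g) [^] p"
    using conj_pow N g by auto
  then show "g \<otimes> h \<otimes> inv g \<in> (\<lambda>g. g [^] p) ` N"
    using normal.inv_op_closed2[OF assms g n(1)] by auto
qed

lemma commutator_normal:
  assumes "N \<lhd> G" "x \<in> N" "y \<in> carrier G"
  shows "commutator G x y \<in> N" "commutator G y x \<in> N"
proof -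
  interpret N: normal N G by fact
  have x: "x \<in> carrier G" by (rule N.mem_carrier[OF assms(2)])
  have "inv x \<otimes> (inv y \<otimes> x \<otimes> y) \<in> N"
    by (intro N.m_closed N.m_inv_closed N.inv_op_closed1 assms)
  then show a: "commutator G x y \<in> N"
    by (simp only: commutator_eq_conj[OF x assms(3)])
  then show "commutator G y x \<in> N"
    by (simp only: commutator_swap[OF x assms(3)] N.m_inv_closed)
qed

lemma commutator_consistent:
  assumes "subgroup H G" "x \<in> H" "y \<in> H"
  shows "commutator (G\<lparr>carrier := H\<rparr>) x y = commutator G x y"
  unfolding commutator_def using assms m_inv_consistent[OF assms(1)] by simp

lemma centralizer_subgroup:
  assumes "S \<subseteq> carrier G"
  shows "subgroup {z \<in> carrier G. \<forall>s\<in>S. z \<otimes> s = s \<otimes> z} G"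
proof (rule subgroupI)
  fix a assume a: "a \<in> {z \<in> carrier G. \<forall>s\<in>S. z \<otimes> s = s \<otimes> z}"
  have "inv a \<otimes> s = s \<otimes> inv a" if "s \<in> S" for s
  proof -
    have s: "a \<otimes> s = s \<otimes> a" "s \<in> carrier G" "a \<in> carrier G" using a that assms by auto
    have "a \<otimes> (s \<otimes> inv a) = (a \<otimes> s) \<otimes> inv a"
      using s(2,3) by (simp add: m_assoc)
    also have "\<dots> = (s \<otimes> a) \<otimes> inv a"
      by (simp only: s(1))
    also have "\<dots> = s"
      using s(2,3) by (simp add: m_assoc)
    finally show ?thesis using s(2,3) inv_solve_left[of "s \<otimes> inv a" a s] by simp
  qed
  then show "inv a \<in> {z \<in> carrier G. \<forall>s\<in>S. z \<otimes> s = s \<otimes> z}" using a by auto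
next
  fix a b assume ab: "a \<in> {z \<in> carrier G. \<forall>s\<in>S. z \<otimes> s = s \<otimes> z}"
     "b \<in> {z \<in> carrier G. \<forall>s\<in>S. z \<otimes> s = s \<otimes> z}"
  have "a \<otimes> b \<otimes> s = s \<otimes> (a \<otimes> b)" if "s \<in> S" for s
  proof -
    have s: "s \<in> carrier G" "a \<otimes> s = s \<otimes> a" "b \<otimes> s = s \<otimes> b" "a \<in> carrier G" "b \<in> carrier G"
      using ab that assms by auto
    have "a \<otimes> b \<otimes> s = a \<otimes> (b \<otimes> s)" using s(1,4,5) by (simp add: m_assoc)
    also have "\<dots> = (a \<otimes> s) \<otimes> b" using s(1,4,5) by (simp only: s(3) m_assoc)
    also have "\<dots> = s \<otimes> (a \<otimes> b)" using s(1,4,5) by (simp only: s(2) m_assoc)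
    finally show ?thesis .
  qed
  then show "a \<otimes> b \<in> {z \<in> carrier G. \<forall>s\<in>S. z \<otimes> s = s \<otimes> z}" using ab by auto
qed (use assms in \<open>auto simp: subset_iff intro!: exI[of _ \<one>]\<close>)

text \<open>Centralizers are subgroups. The centralizer of \<open>T\<close> contains
  \<open>S\<close>, hence \<open>generate G S\<close>; so the centralizer of
  \<open>generate G S\<close> contains \<open>T\<close>, hence \<open>generate G T\<close>.\<close>

lemma generate_commute:
  assumes S: "S \<subseteq> carrier G" and T: "T \<subseteq> carrier G"
    and st: "\<And>s t. s \<in> S \<Longrightarrow> t \<in> T \<Longrightarrow> s \<otimes> t = t \<otimes> s"
    and x: "x \<in> generate G S" and y: "y \<in> generate G T"
  shows "x \<otimes> y = y \<otimes> x"
proof -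
  have 1: "generate G S \<subseteq> {z \<in> carrier G. \<forall>s\<in>T. z \<otimes> s = s \<otimes> z}"
    by (rule generate_subgroup_incl) (use centralizer_subgroup[OF T] S st in auto)
  have gS: "generate G S \<subseteq> carrier G" using generate_incl S by auto
  have 2: "generate G T \<subseteq> {z \<in> carrier G. \<forall>s\<in>generate G S. z \<otimes> s = s \<otimes> z}"
  proof (rule generate_subgroup_incl)
    show "T \<subseteq> {z \<in> carrier G. \<forall>s\<in>generate G S. z \<otimes> s = s \<otimes> z}"
    proof
      fix t assume "t \<in> T"
      moreover have "t \<otimes> s = s \<otimes> t" if "s \<in> generate G S" for s
        using subsetD[OF 1 that] \<open>t \<in> T\<close> by simp
      ultimately show "t \<in> {z \<in> carrier G. \<forall>s\<in>generate G S. z \<otimes> s = s \<otimes> z}"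
        using T by blast
    qed
  qed (rule centralizer_subgroup[OF gS])
  show ?thesis using subsetD[OF 2 y] x by simp
qed

end

section \<open>Commutators and p-th powers under homomorphisms\<close>

lemma (in group_hom) hom_commutator:
  "x \<in> carrier G \<Longrightarrow> y \<in> carrier G \<Longrightarrow> h (commutator G x y) = commutator H (h x) (h y)"
  by (simp add: commutator_def)

lemma (in normal) group_hom_Mod: "group_hom G (G Mod H) (\<lambda>a. H #> a)"
  by (simp add: group_hom_def group_hom_axioms_def factorgroup_is_group r_coset_hom_Mod)

lemma (in normal) Mod_eq_one_iff:
  "a \<in> carrier G \<Longrightarrow> H #> a = \<one>\<^bsub>G Mod H\<^esub> \<longleftrightarrow> a \<in> H"
  unfolding one_FactGroup
  by (rule iffI, rule coset_join1) (assumption | rule subset coset_join2 subgroup_axioms)+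

lemma (in group_hom) agemo_img:
  assumes "K \<subseteq> carrier G"
  shows "h ` agemo p G K = agemo p H (h ` K)"
proof -
  have "h (g [^] p) = h g [^]\<^bsub>H\<^esub> p" if "g \<in> K" for g
    using assms that by (simp add: hom_nat_pow subset_iff)
  then have "h ` (\<lambda>g. g [^] p) ` K = (\<lambda>g. g [^]\<^bsub>H\<^esub> p) ` h ` K"
    unfolding image_image by (rule image_cong[OF refl])
  moreover have "(\<lambda>g. g [^] p) ` K \<subseteq> carrier G" using assms by auto
  ultimately show ?thesis unfolding agemo_def
    using generate_img[of "(\<lambda>g. g [^] p) ` K"] by simp
qed

section \<open>Central quotients of finite p-groups\<close>

context group
begin

text \<open>Central elements commute with each other, so taking p-th powers is multiplicative on
  them. The preimage of this subgroup is what enlarges \<open>K\<close> in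
  \<open>central_quotient\<close>.\<close>

lemma omega_center_normal:
  "{z \<in> carrier G. z [^] (p::nat) = \<one> \<and> (\<forall>g\<in>carrier G. z \<otimes> g = g \<otimes> z)} \<lhd> G" (is "?Z \<lhd> G")
proof (rule normal_invI)
  have c: "subgroup {z \<in> carrier G. \<forall>s\<in>carrier G. z \<otimes> s = s \<otimes> z} G"
    by (rule centralizer_subgroup) simp
  show "subgroup ?Z G"
  proof (rule subgroupI)
    fix a assume a: "a \<in> ?Z"
    then have "inv a \<in> {z \<in> carrier G. \<forall>s\<in>carrier G. z \<otimes> s = s \<otimes> z}"
      by (intro subgroup.m_inv_closed[OF c]) auto
    moreover have "inv a [^] p = \<one>" using a by (simp add: nat_pow_inv)
    ultimately show "inv a \<in> ?Z" by simp
  next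
    fix a b assume a: "a \<in> ?Z" and b: "b \<in> ?Z"
    then have "a \<otimes> b \<in> {z \<in> carrier G. \<forall>s\<in>carrier G. z \<otimes> s = s \<otimes> z}"
      by (intro subgroup.m_closed[OF c]) auto
    moreover have "(a \<otimes> b) [^] p = \<one>"
    proof -
      have "a \<otimes> b = b \<otimes> a" "a \<in> carrier G" "b \<in> carrier G" "a [^] p = \<one>" "b [^] p = \<one>"
        using a b by blast+
      then show ?thesis using pow_mult_distrib[of a b p] by (simp only: r_one one_closed)
    qed
    ultimately show "a \<otimes> b \<in> ?Z" by simp
  qed (auto intro!: exI[of _ \<one>])
  fix x h assume x: "x \<in> carrier G" and h: "h \<in> ?Z"
  have hc: "h \<in> carrier G" "h \<otimes> x = x \<otimes> h" using x h by blast+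
  have "x \<otimes> h \<otimes> inv x = h \<otimes> x \<otimes> inv x" by (simp only: hc)
  also have "\<dots> = h" using x hc(1) by (simp add: m_assoc)
  finally have "x \<otimes> h \<otimes> inv x = h" .
  then show "x \<otimes> h \<otimes> inv x \<in> ?Z" using h by (simp only:)
qed

end

lemma (in group_hom) vimage_normal:
  assumes "N \<lhd> H"
  shows "{z \<in> carrier G. h z \<in> N} \<lhd> G"
proof -
  interpret N: normal N H by fact
  show ?thesis
  proof (rule G.normal_invI)
    show "subgroup {z \<in> carrier G. h z \<in> N} G"
      by (rule G.subgroupI) (auto intro: exI[of _ "\<one>\<^bsub>G\<^esub>"])
    show "x \<otimes> k \<otimes> inv x \<in> {z \<in> carrier G. h z \<in> N}"
      if "x \<in> carrier G" "k \<in> {z \<in> carrier G. h z \<in> N}" for x k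
      using that N.inv_op_closed2 by simp
  qed
qed

section \<open>Finite p-groups for odd p and their centers\<close>

locale odd_p_group = group G for G (structure) +
  fixes p :: nat
  assumes prime_p: "Factorial_Ring.prime p" and odd_p: "odd p"
    and finite_carrier: "finite (carrier G)" and order_pow: "\<exists>n. order G = p ^ n"
begin

lemma odd_p_group_dvd:
  assumes "group H" "finite (carrier H)" "order H dvd order G"
  shows "odd_p_group H p"
proof -
  obtain n where "order G = p ^ n" using order_pow by blast
  then have "\<exists>n. order H = p ^ n" using assms(3) divides_primepow_nat[OF prime_p] by auto
  then show ?thesis
    using assms prime_p odd_p by (simp add: odd_p_group_def odd_p_group_axioms_def)
qed

lemma odd_p_group_subgroup:
  assumes "subgroup H G" shows "odd_p_group (G\<lparr>carrier := H\<rparr>) p"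
proof (rule odd_p_group_dvd)
  show "group (G\<lparr>carrier := H\<rparr>)" by (rule subgroup_imp_group[OF assms])
  show "finite (carrier (G\<lparr>carrier := H\<rparr>))"
    using finite_carrier subgroup.subset[OF assms] finite_subset by simp
  show "order (G\<lparr>carrier := H\<rparr>) dvd order G"
    using lagrange[OF assms] by (simp add: order_def) (metis dvd_triv_right)
qed

lemma odd_p_group_Mod:
  assumes "N \<lhd> G" shows "odd_p_group (G Mod N) p"
proof (rule odd_p_group_dvd)
  show "group (G Mod N)" by (rule normal.factorgroup_is_group[OF assms])
  show "finite (carrier (G Mod N))" using finite_carrier by (simp add: carrier_FactGroup)
  show "order (G Mod N) dvd order G"
    using lagrange[OF normal_imp_subgroup[OF assms]] dvd_triv_left
    by (metis FactGroup_def order_def partial_object.select_convs(1))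
qed

lemma pow_prime_power_eq_one:
  assumes "x \<in> carrier G" shows "\<exists>k. x [^] (p ^ k) = \<one>"
  using order_pow pow_order_eq_1[OF assms] by metis

lemma obtain_order_p:
  assumes "x \<in> carrier G" "x \<noteq> \<one>"
  obtains k where "x [^] (p ^ k) \<noteq> \<one>" "(x [^] (p ^ k)) [^] p = \<one>"
proof -
  define k where "k = (LEAST k. x [^] (p ^ k) = \<one>)"
  have k: "x [^] (p ^ k) = \<one>"
    unfolding k_def using pow_prime_power_eq_one[OF assms(1)] by (rule LeastI_ex)
  then have "k \<noteq> 0" using assms by (cases k) auto
  then obtain j where j: "k = Suc j" using not0_implies_Suc by blast
  then have "x [^] (p ^ j) \<noteq> \<one>"
    using not_less_Least[of j] unfolding k_def[symmetric] by (metis k_def lessI not_less_Least)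
  moreover have "(x [^] (p ^ j)) [^] p = \<one>"
    using k j assms by (simp add: nat_pow_pow mult.commute)
  ultimately show thesis by (rule that)
qed

text \<open>Class equation: if 1 were the only central element, every other conjugacy class would
  have size a power of \<open>p\<close> different from 1. Then the group order would be 1 modulo
  \<open>p\<close>, although \<open>p\<close> divides it.\<close>

lemma center_nontrivial:
  assumes "carrier G \<noteq> {\<one>}"
  shows "\<exists>z\<in>carrier G. z \<noteq> \<one> \<and> (\<forall>g\<in>carrier G. z \<otimes> g = g \<otimes> z)"
proof (rule ccontr)
  assume neg: "\<not> ?thesis"
  define \<phi> where "\<phi> = (\<lambda>g. \<lambda>h\<in>carrier G. g \<otimes> h \<otimes> inv g)"
  interpret A: group_action G "carrier G" \<phi>
    unfolding \<phi>_def by (rule action_by_conjugation)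
  obtain n where n: "order G = p ^ n" using order_pow by blast
  let ?O = "orbits G (carrier G) \<phi>"
  have part: "\<Union>?O = carrier G" "pairwise disjnt ?O"
    using A.orbits_coverture A.disjoint_union by (auto simp: pairwise_def disjnt_def)
  have fin: "finite ?O" using finite_carrier by (simp add: orbits_def)
  have one: "orbit G \<phi> \<one> = {\<one>}"
    unfolding orbit_def \<phi>_def by (auto intro: exI[of _ \<one>])
  have dv: "p dvd card C" if C: "C \<in> ?O" "C \<noteq> {\<one>}" for C
  proof -
    obtain x where x: "x \<in> carrier G" "C = orbit G \<phi> x" using C by (auto simp: orbits_def)
    have "card C dvd p ^ n"
      using A.orbit_stabilizer_theorem[OF x(1)] n x(2) by (metis dvd_triv_left)
    then obtain i where i: "card C = p ^ i" using divides_primepow_nat[OF prime_p] by auto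
    have "card C \<noteq> 1"
    proof
      assume "card C = 1"
      moreover have "\<phi> g x \<in> C" if "g \<in> carrier G" for g using x that by (auto simp: orbit_def)
      moreover have "\<phi> \<one> x = x" using x by (simp add: \<phi>_def)
      ultimately have "\<phi> g x = x" if "g \<in> carrier G" for g
        using that by (metis card_1_singletonE one_closed singletonD)
      then have "g \<otimes> x \<otimes> inv g = x" if "g \<in> carrier G" for g
        using that x by (simp add: \<phi>_def)
      then have "x \<otimes> g = g \<otimes> x" if "g \<in> carrier G" for g
        using that x by (metis inv_solve_right m_closed)
      then have "x = \<one>" using neg x by blast
      then show False using C x one by simp
    qed
    then have "i \<noteq> 0" using i by auto
    then show ?thesis using i by simp
  qed
  have "{\<one>} \<in> ?O" using one unfolding orbits_def by force
  have "order G = card (\<Union>?O)" by (simp only: order_def part(1))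
  also have "\<dots> = (\<Sum>C\<in>?O. card C)"
    by (rule card_Union_disjoint) (use part fin finite_carrier in \<open>auto intro: finite_subset\<close>)
  also have "\<dots> = 1 + (\<Sum>C\<in>?O - {{\<one>}}. card C)"
    using sum.remove[OF fin \<open>{\<one>} \<in> ?O\<close>, of card] by simp
  finally have "order G = 1 + (\<Sum>C\<in>?O - {{\<one>}}. card C)" .
  moreover have "p dvd (\<Sum>C\<in>?O - {{\<one>}}. card C)" by (rule dvd_sum) (use dv in auto)
  moreover have "p dvd order G"
  proof -
    have "n \<noteq> 0"
    proof
      assume "n = 0"
      then have "card (carrier G) = 1" using n by (simp add: order_def)
      then show False using assms by (metis card_1_singletonE one_closed singletonD)
    qed
    then show ?thesis using n by simp
  qed
  ultimately have "p dvd 1" by (metis dvd_add_left_iff)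
  then show False using prime_p by simp
qed

text \<open>In \<open>G Mod K\<close>, the image of \<open>S\<close> is nontrivial, central and of exponent \<open>p\<close>. This is how
  inclusions \<open>S \<subseteq> L\<close> are refuted below, in place of an induction along a central series.\<close>

lemma central_quotient:
  assumes L: "L \<lhd> G" and S: "S \<subseteq> carrier G" "\<not> S \<subseteq> L"
  obtains K where "K \<lhd> G" "L \<subseteq> K" "\<not> S \<subseteq> K"
    "\<And>s g. s \<in> S \<Longrightarrow> g \<in> carrier G \<Longrightarrow> commutator G s g \<in> K"
    "\<And>s. s \<in> S \<Longrightarrow> s [^] p \<in> K"
proof -
  \<comment> \<open>Choose \<open>K\<close> maximal among the normal subgroups that contain
    \<open>L\<close> but not \<open>S\<close>. Any strictly larger normal subgroup must contain
    \<open>S\<close>; this is applied to the preimage \<open>?M\<close> of the central elements of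
    order dividing \<open>p\<close> in \<open>G Mod K\<close>.\<close>
  let ?F = "{K. K \<lhd> G \<and> L \<subseteq> K \<and> \<not> S \<subseteq> K}"
  have "?F \<subseteq> Pow (carrier G)"
    using normal_imp_subgroup subgroup.subset by blast
  then have "finite ?F" using finite_carrier finite_subset by blast
  moreover have "L \<in> ?F" using L S by simp
  ultimately have "\<exists>K\<in>?F. \<forall>M\<in>?F. K \<subseteq> M \<longrightarrow> K = M"
    by (intro finite_has_maximal) auto
  then obtain K where K: "K \<in> ?F" and max: "\<And>M. M \<in> ?F \<Longrightarrow> K \<subseteq> M \<Longrightarrow> K = M"
    by (elim bexE) (use that in blast)
  then have KF: "K \<lhd> G" "L \<subseteq> K" "\<not> S \<subseteq> K" by simp_all
  interpret K: normal K G by (rule KF)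
  interpret Q: odd_p_group "G Mod K" p by (rule odd_p_group_Mod[OF KF(1)])
  interpret f: group_hom G "G Mod K" "\<lambda>a. K #> a" by (rule K.group_hom_Mod)
  let ?Z = "{z \<in> carrier (G Mod K). z [^]\<^bsub>G Mod K\<^esub> p = \<one>\<^bsub>G Mod K\<^esub> \<and>
      (\<forall>g\<in>carrier (G Mod K). z \<otimes>\<^bsub>G Mod K\<^esub> g = g \<otimes>\<^bsub>G Mod K\<^esub> z)}"
  let ?M = "{z \<in> carrier G. K #> z \<in> ?Z}"
  have Z: "?Z \<lhd> G Mod K" by (rule Q.omega_center_normal)
  have M: "?M \<lhd> G" by (rule f.vimage_normal[OF Z])
  have KM: "K \<subseteq> ?M"
  proof
    fix k assume k: "k \<in> K"
    then have "K #> k = \<one>\<^bsub>G Mod K\<^esub>" using K.Mod_eq_one_iff K.mem_carrier by simp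
    moreover have "\<one>\<^bsub>G Mod K\<^esub> \<in> ?Z" using Z normal_imp_subgroup subgroup.one_closed by blast
    ultimately show "k \<in> ?M" using k by simp
  qed
  obtain s where s: "s \<in> S" "s \<notin> K" using KF by auto
  have "carrier (G Mod K) \<noteq> {\<one>\<^bsub>G Mod K\<^esub>}"
  proof -
    have "s \<in> carrier G" using s S by blast
    then have "K #> s \<in> carrier (G Mod K)" "K #> s \<noteq> \<one>\<^bsub>G Mod K\<^esub>"
      using f.hom_closed K.Mod_eq_one_iff s by simp_all
    then show ?thesis by (metis singletonD)
  qed
  then obtain z where z: "z \<in> carrier (G Mod K)" "z \<noteq> \<one>\<^bsub>G Mod K\<^esub>"
    "\<forall>g\<in>carrier (G Mod K). z \<otimes>\<^bsub>G Mod K\<^esub> g = g \<otimes>\<^bsub>G Mod K\<^esub> z" using Q.center_nontrivial by blast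
  \<comment> \<open>A suitable power of the nontrivial central \<open>z\<close> has order exactly
    \<open>p\<close> and is still central, so \<open>?M\<close> is strictly larger than
    \<open>K\<close>.\<close>
  obtain k where k: "z [^]\<^bsub>G Mod K\<^esub> (p ^ k) \<noteq> \<one>\<^bsub>G Mod K\<^esub>"
    "(z [^]\<^bsub>G Mod K\<^esub> (p ^ k)) [^]\<^bsub>G Mod K\<^esub> p = \<one>\<^bsub>G Mod K\<^esub>"
    using Q.obtain_order_p[OF z(1,2)] .
  have kZ: "z [^]\<^bsub>G Mod K\<^esub> (p ^ k) \<in> ?Z"
    using k z Q.commute_pow[OF z(1)] by simp
  then obtain y where y: "y \<in> carrier G" "K #> y = z [^]\<^bsub>G Mod K\<^esub> (p ^ k)"
    by (auto simp: carrier_FactGroup)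
  have "y \<in> ?M" "y \<notin> K" using y kZ k(1) K.Mod_eq_one_iff[OF y(1)] by auto
  then have "?M \<notin> ?F" using max KM by blast
  then have "S \<subseteq> ?M" using M KM KF by blast
  show thesis
  proof
    show "K \<lhd> G" "L \<subseteq> K" "\<not> S \<subseteq> K" by (rule KF)+
    fix s assume "s \<in> S"
    then have sM: "s \<in> carrier G" "K #> s \<in> ?Z" using \<open>S \<subseteq> ?M\<close> by auto
    then show "s [^] p \<in> K"
      using K.Mod_eq_one_iff[of "s [^] p"] f.hom_nat_pow[of s p] by simp
    fix g assume g: "g \<in> carrier G"
    then show "commutator G s g \<in> K"
      using K.Mod_eq_one_iff[of "commutator G s g"] f.hom_commutator[of s g]
       Q.commutator_eq_one_iff[of "K #> s" "K #> g"] sM by simp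
  qed
qed

end

section \<open>Powerfully embedded subgroups\<close>

definition comm_powerful :: "nat \<Rightarrow> ('a, 'b) monoid_scheme \<Rightarrow> bool" where
  "comm_powerful p G \<longleftrightarrow>
     (\<forall>a\<in>carrier G. \<forall>b\<in>carrier G. commutator G a b \<in> agemo p G (carrier G))"

text \<open>The condition [N, G] \<le> N^p on a normal subgroup, tested on single commutators
  because \<open>agemo\<close> is a subgroup. For \<open>N = carrier G\<close> it amounts to
  \<open>comm_powerful\<close>. Unlike powerfulness of N alone, it passes down the series N, N^p,
  (N^p)^p inside \<open>G\<close>.\<close>

definition powerfully_embedded :: "nat \<Rightarrow> ('a, 'b) monoid_scheme \<Rightarrow> 'a set \<Rightarrow> bool" where
  "powerfully_embedded p G N \<longleftrightarrow>
     N \<lhd> G \<and> (\<forall>n\<in>N. \<forall>g\<in>carrier G. commutator G n g \<in> agemo p G N)"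

lemma (in group) commutator_generate_eq_one:
  assumes "S \<subseteq> carrier G" "T \<subseteq> carrier G"
    "\<And>s t. s \<in> S \<Longrightarrow> t \<in> T \<Longrightarrow> commutator G s t = \<one>"
    "x \<in> generate G S" "y \<in> generate G T"
  shows "commutator G x y = \<one>"
proof -
  have "x \<otimes> y = y \<otimes> x"
    by (rule generate_commute[OF assms(1,2) _ assms(4,5)])
       (use assms commutator_eq_one_iff in blast)
  then show ?thesis
    using commutator_eq_one_iff generate_in_carrier assms by simp
qed

text \<open>Modulo \<open>K\<close> the two generating sets commute elementwise, hence so do the
  subgroups they generate. Commutator bounds thus need checking on generators only.\<close>

lemma (in group) commutator_generate_in_normal:
  assumes "K \<lhd> G" "S \<subseteq> carrier G" "T \<subseteq> carrier G"
    "\<And>s t. s \<in> S \<Longrightarrow> t \<in> T \<Longrightarrow> commutator G s t \<in> K"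
    "x \<in> generate G S" "y \<in> generate G T"
  shows "commutator G x y \<in> K"
proof -
  interpret K: normal K G by fact
  interpret f: group_hom G "G Mod K" "\<lambda>a. K #> a" by (rule K.group_hom_Mod)
  have c: "x \<in> carrier G" "y \<in> carrier G" using generate_in_carrier assms by blast+
  have "commutator (G Mod K) (K #> x) (K #> y) = \<one>\<^bsub>G Mod K\<^esub>"
  proof (rule f.H.commutator_generate_eq_one)
    show "K #> x \<in> generate (G Mod K) ((\<lambda>a. K #> a) ` S)"
      using f.generate_img[OF assms(2)] assms(5) by blast
    show "K #> y \<in> generate (G Mod K) ((\<lambda>a. K #> a) ` T)"
      using f.generate_img[OF assms(3)] assms(6) by blast
    fix s t assume "s \<in> (\<lambda>a. K #> a) ` S" "t \<in> (\<lambda>a. K #> a) ` T"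
    then obtain a b where ab: "a \<in> S" "b \<in> T" "s = K #> a" "t = K #> b" by blast
    then have "a \<in> carrier G" "b \<in> carrier G" using assms by auto
    then show "commutator (G Mod K) s t = \<one>\<^bsub>G Mod K\<^esub>"
      using ab assms(4)[OF ab(1,2)] K.Mod_eq_one_iff[of "commutator G a b"] f.hom_commutator[of a b]
      by simp
  qed (use assms f.hom_closed in blast)+
  then show ?thesis
    using K.Mod_eq_one_iff[of "commutator G x y"] f.hom_commutator[of x y] c by simp
qed

text \<open>This is \<open>commute_pow_of_class2\<close> read in \<open>G Mod K\<close>, with each
  condition on cosets expressed as membership in \<open>K\<close>.\<close>

lemma (in group) commutator_pow_in_normal:
  assumes K: "K \<lhd> G" and c: "x \<in> carrier G" "y \<in> carrier G" and p: "odd (p::nat)"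
    and u: "u = commutator G x y" and t: "t = commutator G u x"
    and tx: "commutator G t x \<in> K" and tu: "commutator G t u \<in> K"
    and up: "u [^] p \<in> K" and tp: "t [^] p \<in> K"
  shows "commutator G (x [^] p) y \<in> K"
proof -
  interpret K: normal K G by fact
  interpret f: group_hom G "G Mod K" "\<lambda>a. K #> a" by (rule K.group_hom_Mod)
  have uc: "u \<in> carrier G" "t \<in> carrier G" using c u t by auto
  let ?u = "K #> u" and ?t = "K #> t" and ?x = "K #> x" and ?y = "K #> y"
  have fc: "?u \<in> carrier (G Mod K)" "?t \<in> carrier (G Mod K)"
     "?x \<in> carrier (G Mod K)" "?y \<in> carrier (G Mod K)"
    using f.hom_closed c uc by blast+
  have "?x [^]\<^bsub>G Mod K\<^esub> p \<otimes>\<^bsub>G Mod K\<^esub> ?y = ?y \<otimes>\<^bsub>G Mod K\<^esub> ?x [^]\<^bsub>G Mod K\<^esub> p"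
  proof (rule f.H.commute_pow_of_class2[OF fc(3,4) p])
    show "?u = commutator (G Mod K) ?x ?y" "?t = commutator (G Mod K) ?u ?x"
      using f.hom_commutator u t c uc by blast+
    have "commutator (G Mod K) ?t ?x = \<one>\<^bsub>G Mod K\<^esub>"
      using tx uc c K.Mod_eq_one_iff[of "commutator G t x"] f.hom_commutator[of t x] by simp
    then show "?t \<otimes>\<^bsub>G Mod K\<^esub> ?x = ?x \<otimes>\<^bsub>G Mod K\<^esub> ?t"
      using f.H.commutator_eq_one_iff fc by blast
    have "commutator (G Mod K) ?t ?u = \<one>\<^bsub>G Mod K\<^esub>"
      using tu uc c K.Mod_eq_one_iff[of "commutator G t u"] f.hom_commutator[of t u] by simp
    then show "?t \<otimes>\<^bsub>G Mod K\<^esub> ?u = ?u \<otimes>\<^bsub>G Mod K\<^esub> ?t"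
      using f.H.commutator_eq_one_iff fc by blast
    show "?u [^]\<^bsub>G Mod K\<^esub> p = \<one>\<^bsub>G Mod K\<^esub>"
      using K.Mod_eq_one_iff[of "u [^] p"] f.hom_nat_pow[of u p] up uc by simp
    show "?t [^]\<^bsub>G Mod K\<^esub> p = \<one>\<^bsub>G Mod K\<^esub>"
      using K.Mod_eq_one_iff[of "t [^] p"] f.hom_nat_pow[of t p] tp uc by simp
  qed
  then have "commutator (G Mod K) (?x [^]\<^bsub>G Mod K\<^esub> p) ?y = \<one>\<^bsub>G Mod K\<^esub>"
    using f.H.commutator_eq_one_iff fc f.H.nat_pow_closed by blast
  then show ?thesis
    using K.Mod_eq_one_iff[of "commutator G (x [^] p) y"] f.hom_commutator[of "x [^] p" y]
      f.hom_nat_pow[of x p] c by simp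
qed

context odd_p_group
begin

text \<open>Otherwise pass to a quotient where (N^p)^p is trivial and [N^p, G] is nontrivial,
  central and of exponent \<open>p\<close>. There u = [n, g] lies in N^p, so u^p = 1, and t = [u, n]
  lies in [N^p, G]. The class two criterion makes n^p central, so [N^p, G] vanishes after
  all.\<close>

lemma embedded_agemo:
  assumes N: "powerfully_embedded p G N" shows "powerfully_embedded p G (agemo p G N)"
proof -
  let ?A = "agemo p G N" and ?B = "agemo p G (agemo p G N)"
  have nN: "N \<lhd> G" using N by (simp add: powerfully_embedded_def)
  have nA: "?A \<lhd> G" and nB: "?B \<lhd> G" by (intro agemo_normal nN)+
  have sub: "N \<subseteq> carrier G" "?A \<subseteq> carrier G"
    using nN nA normal_imp_subgroup subgroup.subset by blast+
  let ?S = "{commutator G w g |w g. w \<in> ?A \<and> g \<in> carrier G}"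
  have "?S \<subseteq> ?B"
  proof (rule ccontr)
    assume S: "\<not> ?S \<subseteq> ?B"
    have Sc: "?S \<subseteq> carrier G" using sub by auto
    obtain K where K: "K \<lhd> G" "?B \<subseteq> K" "\<not> ?S \<subseteq> K"
      and comm: "\<And>s g. s \<in> ?S \<Longrightarrow> g \<in> carrier G \<Longrightarrow> commutator G s g \<in> K"
      and pow: "\<And>s. s \<in> ?S \<Longrightarrow> s [^] p \<in> K"
      by (rule central_quotient[OF nB Sc S]) (rule that)
    have *: "commutator G (n [^] p) g \<in> K" if n: "n \<in> N" and g: "g \<in> carrier G" for n g
    proof (rule commutator_pow_in_normal[OF K(1) _ g odd_p refl refl])
      have nc: "n \<in> carrier G" using n sub by blast
      then show "n \<in> carrier G" .
      have u: "commutator G n g \<in> ?A" using N n g by (simp add: powerfully_embedded_def)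
      then have t: "commutator G (commutator G n g) n \<in> ?S" using nc by blast
      show "commutator G n g [^] p \<in> K" using u K(2) agemo_pow by blast
      show "commutator G (commutator G n g) n [^] p \<in> K" by (rule pow[OF t])
      show "commutator G (commutator G (commutator G n g) n) n \<in> K" by (rule comm[OF t nc])
      show "commutator G (commutator G (commutator G n g) n) (commutator G n g) \<in> K"
        by (rule comm[OF t]) (use nc g in simp)
    qed
    have "commutator G w g \<in> K" if "w \<in> ?A" "g \<in> carrier G" for w g
    proof (rule commutator_generate_in_normal[OF K(1)])
      show "w \<in> generate G ((\<lambda>n. n [^] p) ` N)" using that by (simp add: agemo_def)
      show "g \<in> generate G (carrier G)" using that by (intro generate.incl)
      show "(\<lambda>n. n [^] p) ` N \<subseteq> carrier G" using sub by auto
    qed (use * in auto)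
    then have "?S \<subseteq> K" by blast
    then show False using K(3) by blast
  qed
  then show ?thesis using nA unfolding powerfully_embedded_def by blast
qed

lemma comm_powerful_imp_embedded:
  assumes "comm_powerful p G" shows "powerfully_embedded p G (carrier G)"
  using assms normal_self by (simp add: comm_powerful_def powerfully_embedded_def)

text \<open>[N, N] lies in [N, G] and so in N^p. Results on powerful groups thereby apply to each
  term of the series G, G^p, (G^p)^p.\<close>

lemma embedded_comm_powerful:
  assumes "powerfully_embedded p G N" shows "comm_powerful p (G\<lparr>carrier := N\<rparr>)"
proof -
  have N: "subgroup N G" using assms normal_imp_subgroup by (auto simp: powerfully_embedded_def)
  then have "N \<subseteq> carrier G" by (rule subgroup.subset)
  then show ?thesis
    using assms commutator_consistent[OF N] agemo_consistent[OF subset_refl N]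
    unfolding comm_powerful_def powerfully_embedded_def by auto
qed

text \<open>The commutators are shown to die in a class two quotient, where the \<open>p\<close>-th powers are
  central and so the whole quotient is abelian.\<close>

lemma abelian_if_cyclic_mod_agemo:
  assumes x: "x \<in> carrier G"
    and gen: "generate G (insert x (agemo p G (carrier G))) = carrier G"
    and ab: "a \<in> carrier G" "b \<in> carrier G"
  shows "a \<otimes> b = b \<otimes> a"
proof -
  let ?A = "agemo p G (carrier G)"
  let ?S = "{commutator G a b |a b. a \<in> carrier G \<and> b \<in> carrier G}"
  have Ac: "?A \<subseteq> carrier G" by (rule subgroup.subset[OF agemo_subgroup[OF subset_refl]])
  have "?S \<subseteq> {\<one>}"
  proof (rule ccontr)
    assume S: "\<not> ?S \<subseteq> {\<one>}"
    have Sc: "?S \<subseteq> carrier G" by auto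
    obtain K where K: "K \<lhd> G" "{\<one>} \<subseteq> K" "\<not> ?S \<subseteq> K"
      and comm: "\<And>s g. s \<in> ?S \<Longrightarrow> g \<in> carrier G \<Longrightarrow> commutator G s g \<in> K"
      and pow: "\<And>s. s \<in> ?S \<Longrightarrow> s [^] p \<in> K"
      by (rule central_quotient[OF one_is_normal Sc S]) (rule that)
    have *: "commutator G (n [^] p) g \<in> K" if n: "n \<in> carrier G" and g: "g \<in> carrier G" for n g
    proof (rule commutator_pow_in_normal[OF K(1) n g odd_p refl refl])
      have u: "commutator G n g \<in> ?S" using n g by blast
      have t: "commutator G (commutator G n g) n \<in> ?S" using n g by blast
      show "commutator G n g [^] p \<in> K" by (rule pow[OF u])
      show "commutator G (commutator G n g) n [^] p \<in> K" by (rule pow[OF t])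
      show "commutator G (commutator G (commutator G n g) n) n \<in> K" by (rule comm[OF t n])
      show "commutator G (commutator G (commutator G n g) n) (commutator G n g) \<in> K"
        by (rule comm[OF t]) (use n g in simp)
    qed
    have A: "commutator G w g \<in> K" if "w \<in> ?A" "g \<in> carrier G" for w g
    proof (rule commutator_generate_in_normal[OF K(1)])
      show "w \<in> generate G ((\<lambda>n. n [^] p) ` carrier G)" using that by (simp add: agemo_def)
      show "g \<in> generate G (carrier G)" using that by (intro generate.incl)
      show "(\<lambda>n. n [^] p) ` carrier G \<subseteq> carrier G" by auto
    qed (use * in auto)
    have xx: "commutator G x x \<in> K" using x K(2) commutator_eq_one_iff[of x x] by simp
    have xA: "commutator G x w \<in> K" if "w \<in> ?A" for w
      using A[OF that x] commutator_swap[of w x] x that Ac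
        subgroup.m_inv_closed[OF normal_imp_subgroup[OF K(1)]] by auto
    have "commutator G a b \<in> K" if "a \<in> carrier G" "b \<in> carrier G" for a b
    proof (rule commutator_generate_in_normal[OF K(1)])
      show "insert x ?A \<subseteq> carrier G" "insert x ?A \<subseteq> carrier G" using x Ac by auto
      show "commutator G s t \<in> K" if "s \<in> insert x ?A" "t \<in> insert x ?A" for s t
        using that xx xA A x Ac by blast
    qed (use that gen in auto)
    then show False using K(3) by blast
  qed
  then show ?thesis using ab commutator_eq_one_iff[OF ab] by blast
qed

end

section \<open>Powerful groups\<close>

text \<open>With central commutators of exponent \<open>p\<close>, the class two formula reads (v
  w)^p = v^p w^p, so the p-th powers already form a subgroup.\<close>

lemma (in group) agemo_eq_powers_class2:
  assumes p: "odd (p::nat)"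
    and comm: "\<And>a b g. a \<in> carrier G \<Longrightarrow> b \<in> carrier G \<Longrightarrow> g \<in> carrier G \<Longrightarrow>
       commutator G a b \<otimes> g = g \<otimes> commutator G a b"
    and pow: "\<And>a b. a \<in> carrier G \<Longrightarrow> b \<in> carrier G \<Longrightarrow> commutator G a b [^] p = \<one>"
    and g: "g \<in> agemo p G (carrier G)"
  shows "\<exists>v\<in>carrier G. g = v [^] p"
proof -
  let ?P = "(\<lambda>v. v [^] p) ` carrier G"
  have "subgroup ?P G"
  proof (rule subgroupI)
    fix a assume "a \<in> ?P"
    then obtain v where "v \<in> carrier G" "a = v [^] p" by blast
    then have "inv a = inv v [^] p" "inv v \<in> carrier G" by (simp_all add: nat_pow_inv)
    then show "inv a \<in> ?P" by blast
  next
    fix a b assume "a \<in> ?P" "b \<in> ?P"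
    then obtain v w where v: "v \<in> carrier G" "a = v [^] p" and w: "w \<in> carrier G" "b = w [^] p"
      by blast
    let ?t = "commutator G w v"
    have t: "?t \<in> carrier G" using v w by simp
    have "(v \<otimes> w) [^] p = v [^] p \<otimes> w [^] p \<otimes> ?t [^] (p choose 2)"
      by (rule pow_mult_class2[OF v(1) w(1) t mult_eq_commutator[OF w(1) v(1)]])
         (use comm v w in blast)+
    then have "a \<otimes> b = (v \<otimes> w) [^] p"
      using pow_odd_choose_two[OF t pow[OF w(1) v(1)] p] v w by simp
    then show "a \<otimes> b \<in> ?P" using v w by blast
  qed auto
  then have "agemo p G (carrier G) \<subseteq> ?P" by (rule agemo_least) auto
  then show ?thesis using g by blast
qed

text \<open>Inverses and conjugates preserve the order, so closure under products is the only real
  condition. It is asked for inside \<open>M\<close>, while the normality obtained is in all of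
  \<open>G\<close>.\<close>

lemma (in group) order_p_normal:
  assumes M: "M \<lhd> G"
    and closed: "\<And>a b. a \<in> M \<Longrightarrow> b \<in> M \<Longrightarrow> a [^] (p::nat) = \<one> \<Longrightarrow> b [^] p = \<one> \<Longrightarrow> (a \<otimes> b) [^] p = \<one>"
  shows "{m \<in> M. m [^] p = \<one>} \<lhd> G"
proof -
  interpret M: normal M G by fact
  show ?thesis
  proof (rule normal_invI)
    show "subgroup {m \<in> M. m [^] p = \<one>} G"
    proof (rule subgroupI)
      show "{m \<in> M. m [^] p = \<one>} \<noteq> {}" using M.one_closed nat_pow_one by blast
    qed (use closed M.mem_carrier in \<open>auto simp: nat_pow_inv\<close>)
    show "x \<otimes> h \<otimes> inv x \<in> {m \<in> M. m [^] p = \<one>}"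
      if "x \<in> carrier G" "h \<in> {m \<in> M. m [^] p = \<one>}" for x h
      using that M.inv_op_closed2 M.mem_carrier by (auto simp: conj_pow)
  qed
qed

lemma (in group_hom) comm_powerful_image:
  assumes "h ` carrier G = carrier H" "comm_powerful p G"
  shows "comm_powerful p H"
  unfolding comm_powerful_def
proof (intro ballI)
  fix a b assume "a \<in> carrier H" "b \<in> carrier H"
  then obtain x y where xy: "x \<in> carrier G" "a = h x" "y \<in> carrier G" "b = h y"
    using assms(1) by (metis imageE)
  then have "h (commutator G x y) \<in> h ` agemo p G (carrier G)"
    using assms(2) by (simp add: comm_powerful_def)
  then show "commutator H a b \<in> agemo p H (carrier H)"
    using xy agemo_img[OF subset_refl] assms(1) by (simp add: hom_commutator)
qed

section \<open>The subgroup generated by one element and all p-th powers\<close>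

context odd_p_group
begin

text \<open>By \<open>abelian_if_cyclic_mod_agemo\<close> this subgroup is proper when
  \<open>G\<close> is nonabelian, so inductions on the group order can descend to it.\<close>

abbreviation adjoin_agemo :: "'a \<Rightarrow> 'a set" where
  "adjoin_agemo x \<equiv> generate G (insert x (agemo p G (carrier G)))"

lemma agemo_carrier_subset: "agemo p G (carrier G) \<subseteq> carrier G"
  by (rule subgroup.subset[OF agemo_subgroup[OF subset_refl]])

lemma adjoin_agemo_subgroup: "x \<in> carrier G \<Longrightarrow> subgroup (adjoin_agemo x) G"
  by (rule generate_is_subgroup) (use agemo_carrier_subset in auto)

lemma agemo_subset_adjoin: "agemo p G (carrier G) \<subseteq> adjoin_agemo x"
  by (auto intro: generate.incl)

text \<open>The subgroup contains G^p and with it all commutators, so conjugation changes its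
  elements by factors that it contains.\<close>

lemma adjoin_agemo_normal:
  assumes "comm_powerful p G" and x: "x \<in> carrier G"
  shows "adjoin_agemo x \<lhd> G"
proof (rule normal_invI[OF adjoin_agemo_subgroup[OF x]])
  interpret M: subgroup "adjoin_agemo x" G by (rule adjoin_agemo_subgroup[OF x])
  fix g m assume g: "g \<in> carrier G" and m: "m \<in> adjoin_agemo x"
  have mc: "m \<in> carrier G" using m by (rule M.mem_carrier)
  have "commutator G m (inv g) \<in> adjoin_agemo x"
    using assms(1) g mc agemo_subset_adjoin by (auto simp: comm_powerful_def)
  moreover have "g \<otimes> m \<otimes> inv g = m \<otimes> commutator G m (inv g)"
    using conj_eq_commutator[of m "inv g"] g mc by simp
  ultimately show "g \<otimes> m \<otimes> inv g \<in> adjoin_agemo x"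
    using m M.m_closed by simp
qed

text \<open>Write M for the subgroup. Among its generators, \<open>x\<close> commutes with itself
  and every other commutator lies in [G^p, G] \<le> (G^p)^p. Hence [M, M] \<le> (G^p)^p, and this is
  contained in M^p because G^p \<le> M.\<close>

lemma adjoin_agemo_powerful:
  assumes pw: "comm_powerful p G" and x: "x \<in> carrier G"
  shows "comm_powerful p (G\<lparr>carrier := adjoin_agemo x\<rparr>)"
proof -
  let ?A = "agemo p G (carrier G)" and ?M = "adjoin_agemo x"
  have M: "subgroup ?M G" by (rule adjoin_agemo_subgroup[OF x])
  have eA: "powerfully_embedded p G ?A" using pw comm_powerful_imp_embedded embedded_agemo by blast
  have B: "agemo p G ?A \<lhd> G" using eA agemo_normal by (simp add: powerfully_embedded_def)
  have A: "commutator G w g \<in> agemo p G ?A" if "w \<in> ?A" "g \<in> carrier G" for w g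
    using eA that by (simp add: powerfully_embedded_def)
  have xA: "commutator G x w \<in> agemo p G ?A" if "w \<in> ?A" for w
  proof -
    have "w \<in> carrier G" using that agemo_carrier_subset by blast
    then show ?thesis
      using A[OF that x] commutator_swap[of w x] x
        subgroup.m_inv_closed[OF normal_imp_subgroup[OF B]] by simp
  qed
  have xx: "commutator G x x \<in> agemo p G ?A"
    using x commutator_eq_one_iff[of x x] subgroup.one_closed[OF normal_imp_subgroup[OF B]] by simp
  have "commutator G a b \<in> agemo p G ?M" if "a \<in> ?M" "b \<in> ?M" for a b
  proof -
    have "commutator G a b \<in> agemo p G ?A"
    proof (rule commutator_generate_in_normal[OF B _ _ _ that])
      show "insert x ?A \<subseteq> carrier G" "insert x ?A \<subseteq> carrier G"
        using x agemo_carrier_subset by auto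
      show "commutator G s t \<in> agemo p G ?A" if "s \<in> insert x ?A" "t \<in> insert x ?A" for s t
      proof (cases "s = x")
        case True
        then show ?thesis using that xx xA by blast
      next
        case False
        then show ?thesis using that x A agemo_carrier_subset by blast
      qed
    qed
    then show ?thesis using agemo_mono[OF agemo_subset_adjoin] by blast
  qed
  then show ?thesis
    using commutator_consistent[OF M] agemo_consistent[OF subset_refl M]
    by (simp add: comm_powerful_def)
qed

end

text \<open>Modulo (G^p)^p commutators are central of exponent \<open>p\<close>, so the class two
  case gives g = v^p w with w in (G^p)^p. The error w is absorbed by induction on the order, inside
  the subgroup generated by v and G^p.\<close>

lemma agemo_eq_powers:
  assumes "odd_p_group G p" "comm_powerful p G" "g \<in> agemo p G (carrier G)"
  shows "\<exists>v\<in>carrier G. g = v [^]\<^bsub>G\<^esub> p"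
  using assms
proof (induction "card (carrier G)" arbitrary: G g rule: less_induct)
  case less
  interpret odd_p_group G p by fact
  note pw = less.prems(2)
  let ?A = "agemo p G (carrier G)"
  let ?B = "agemo p G ?A"
  have eA: "powerfully_embedded p G ?A" using pw comm_powerful_imp_embedded embedded_agemo by blast
  have B: "?B \<lhd> G" using eA agemo_normal by (simp add: powerfully_embedded_def)
  interpret B: normal ?B G by (rule B)
  interpret Q: odd_p_group "G Mod ?B" p by (rule odd_p_group_Mod[OF B])
  interpret f: group_hom G "G Mod ?B" "\<lambda>a. ?B #>\<^bsub>G\<^esub> a" by (rule B.group_hom_Mod)
  have sur: "(\<lambda>a. ?B #>\<^bsub>G\<^esub> a) ` carrier G = carrier (G Mod ?B)" by (simp add: carrier_FactGroup)
  have g: "g \<in> carrier G" using less.prems(3) agemo_carrier_subset by blast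
  have "\<exists>v\<in>carrier (G Mod ?B). ?B #>\<^bsub>G\<^esub> g = v [^]\<^bsub>G Mod ?B\<^esub> p"
  proof (rule Q.agemo_eq_powers_class2[OF odd_p])
    show "?B #>\<^bsub>G\<^esub> g \<in> agemo p (G Mod ?B) (carrier (G Mod ?B))"
      using imageI[OF less.prems(3), of "\<lambda>a. ?B #>\<^bsub>G\<^esub> a"]
      by (simp only: f.agemo_img[OF subset_refl] sur)
    fix a b assume "a \<in> carrier (G Mod ?B)" "b \<in> carrier (G Mod ?B)"
    then have "a \<in> (\<lambda>a. ?B #>\<^bsub>G\<^esub> a) ` carrier G" "b \<in> (\<lambda>a. ?B #>\<^bsub>G\<^esub> a) ` carrier G"
      by (simp_all only: sur)
    then obtain x y where xy: "x \<in> carrier G" "y \<in> carrier G" "a = ?B #>\<^bsub>G\<^esub> x" "b = ?B #>\<^bsub>G\<^esub> y"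
      by (elim imageE) (rule that)
    have u: "commutator G x y \<in> ?A" using pw xy by (simp add: comm_powerful_def)
    have ab: "commutator (G Mod ?B) a b = ?B #>\<^bsub>G\<^esub> commutator G x y"
      using xy f.hom_commutator by simp
    show "commutator (G Mod ?B) a b [^]\<^bsub>G Mod ?B\<^esub> p = \<one>\<^bsub>G Mod ?B\<^esub>"
      using ab xy f.hom_nat_pow[of "commutator G x y" p] agemo_pow[OF u, of p]
        B.Mod_eq_one_iff[of "commutator G x y [^]\<^bsub>G\<^esub> p"] by simp
    fix c assume "c \<in> carrier (G Mod ?B)"
    then obtain z where z: "z \<in> carrier G" "c = ?B #>\<^bsub>G\<^esub> z" using sur by blast
    have "commutator G (commutator G x y) z \<in> ?B" using eA u z by (simp add: powerfully_embedded_def)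
    then have "commutator (G Mod ?B) (commutator (G Mod ?B) a b) c = \<one>\<^bsub>G Mod ?B\<^esub>"
      using ab xy z f.hom_commutator[of "commutator G x y" z]
        B.Mod_eq_one_iff[of "commutator G (commutator G x y) z"] by simp
    moreover have "commutator (G Mod ?B) a b \<in> carrier (G Mod ?B)" "c \<in> carrier (G Mod ?B)"
      using xy z f.hom_closed by auto
    ultimately show "commutator (G Mod ?B) a b \<otimes>\<^bsub>G Mod ?B\<^esub> c = c \<otimes>\<^bsub>G Mod ?B\<^esub> commutator (G Mod ?B) a b"
      using Q.commutator_eq_one_iff by blast
  qed
  then have "\<exists>v\<in>(\<lambda>a. ?B #>\<^bsub>G\<^esub> a) ` carrier G. ?B #>\<^bsub>G\<^esub> g = v [^]\<^bsub>G Mod ?B\<^esub> p"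
    by (simp only: sur)
  then obtain v where v: "v \<in> carrier G" "?B #>\<^bsub>G\<^esub> g = (?B #>\<^bsub>G\<^esub> v) [^]\<^bsub>G Mod ?B\<^esub> p"
    by (elim bexE imageE) (use that in simp)
  let ?w = "inv\<^bsub>G\<^esub> (v [^]\<^bsub>G\<^esub> p) \<otimes>\<^bsub>G\<^esub> g"
  have "?B #>\<^bsub>G\<^esub> g = ?B #>\<^bsub>G\<^esub> (v [^]\<^bsub>G\<^esub> p)" using v f.hom_nat_pow by simp
  then have "?B #>\<^bsub>G\<^esub> ?w = \<one>\<^bsub>G Mod ?B\<^esub>"
    using v(1) g f.hom_mult[of "inv\<^bsub>G\<^esub> (v [^]\<^bsub>G\<^esub> p)" g] f.hom_inv[of "v [^]\<^bsub>G\<^esub> p"]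
      f.hom_closed[of "v [^]\<^bsub>G\<^esub> p"] Q.l_inv by (simp del: one_FactGroup mult_FactGroup)
  then have w: "?w \<in> ?B" using B.Mod_eq_one_iff[of ?w] v(1) g by simp
  have gw: "g = v [^]\<^bsub>G\<^esub> p \<otimes>\<^bsub>G\<^esub> ?w" using v(1) g by (simp flip: m_assoc)
  \<comment> \<open>Both factors of \<open>g\<close> lie in M^p: the first since \<open>v\<close> is
    in \<open>?M\<close>, the second since G^p \<le> \<open>?M\<close>. So a proper
    \<open>?M\<close> is covered by induction; otherwise \<open>G\<close> is abelian.\<close>
  let ?M = "adjoin_agemo v"
  show ?case
  proof (cases "?M = carrier G")
    case True
    have ab: "a \<otimes>\<^bsub>G\<^esub> b = b \<otimes>\<^bsub>G\<^esub> a" if "a \<in> carrier G" "b \<in> carrier G" for a b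
      using abelian_if_cyclic_mod_agemo[OF v(1) True that] .
    then have "commutator G a b = \<one>\<^bsub>G\<^esub>" if "a \<in> carrier G" "b \<in> carrier G" for a b
      using commutator_eq_one_iff that by blast
    then show ?thesis
      by (intro agemo_eq_powers_class2[OF odd_p _ _ less.prems(3)]) simp_all
  next
    case False
    have M: "subgroup ?M G" by (rule adjoin_agemo_subgroup[OF v(1)])
    let ?H = "G\<lparr>carrier := ?M\<rparr>"
    have "card (carrier ?H) < card (carrier G)"
      using False subgroup.subset[OF M] finite_carrier by (simp add: psubset_card_mono psubsetI)
    moreover have "g \<in> agemo p ?H (carrier ?H)"
    proof -
      have "subgroup (agemo p G ?M) G" by (rule agemo_subgroup[OF subgroup.subset[OF M]])
      moreover have "v [^]\<^bsub>G\<^esub> p \<in> agemo p G ?M" by (intro agemo_pow generate.incl) simp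
      moreover have "?w \<in> agemo p G ?M" using w agemo_mono[OF agemo_subset_adjoin] by blast
      ultimately have "g \<in> agemo p G ?M" using gw subgroup.m_closed by metis
      then show ?thesis using agemo_consistent[OF subset_refl M] by simp
    qed
    ultimately have "\<exists>v\<in>carrier ?H. g = v [^]\<^bsub>?H\<^esub> p"
      by (intro less.hyps odd_p_group_subgroup[OF M] adjoin_agemo_powerful[OF pw v(1)])
    then show ?thesis
      using subgroup.subset[OF M] by (auto simp flip: nat_pow_consistent)
  qed
qed

context odd_p_group
begin

lemma embedded_agemo_eq_powers:
  assumes "powerfully_embedded p G N" "g \<in> agemo p G N"
  shows "\<exists>v\<in>N. g = v [^] p"
proof -
  have N: "subgroup N G" using assms normal_imp_subgroup by (auto simp: powerfully_embedded_def)
  have "\<exists>v\<in>carrier (G\<lparr>carrier := N\<rparr>). g = v [^]\<^bsub>G\<lparr>carrier := N\<rparr>\<^esub> p"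
    by (rule agemo_eq_powers[OF odd_p_group_subgroup[OF N] embedded_comm_powerful[OF assms(1)]])
       (use agemo_consistent[OF subset_refl N] assms in simp)
  then show ?thesis by (simp flip: nat_pow_consistent)
qed

text \<open>Quotients are transported to the type \<^typ>\<open>nat\<close> so that an induction over groups of one
  fixed type can pass to them.\<close>

lemma nat_quotient:
  assumes N: "N \<lhd> G"
  obtains Q :: "nat monoid" and f where
    "odd_p_group Q p" "group_hom G Q f" "f ` carrier G = carrier Q"
    "\<And>a. a \<in> carrier G \<Longrightarrow> f a = \<one>\<^bsub>Q\<^esub> \<longleftrightarrow> a \<in> N"
    "card (carrier Q) * card N = card (carrier G)"
proof -
  interpret N: normal N G by fact
  interpret Q: odd_p_group "G Mod N" p by (rule odd_p_group_Mod[OF N])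
  interpret f: group_hom G "G Mod N" "\<lambda>a. N #> a" by (rule N.group_hom_Mod)
  obtain h :: "'a set \<Rightarrow> nat" where h: "inj_on h (carrier (G Mod N))"
    using finite_imp_inj_to_nat_seg[OF Q.finite_carrier] by blast
  let ?Q = "image_group h (G Mod N)"
  have iso: "h \<in> iso (G Mod N) ?Q" by (rule inj_imp_image_group_iso[OF h])
  have gQ: "group ?Q" by (rule Q.inj_imp_image_group_is_group[OF h])
  have cQ: "carrier ?Q = h ` carrier (G Mod N)" by (rule image_group_carrier)
  then have card: "card (carrier ?Q) = card (carrier (G Mod N))" by (simp add: card_image h)
  have hh: "h \<in> hom (G Mod N) ?Q" using iso by (simp add: iso_def)
  have fh: "group_hom G ?Q (h \<circ> (\<lambda>a. N #> a))"
    using Group.hom_compose[OF f.homh hh] gQ is_group by (simp add: group_hom_def group_hom_axioms_def)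
  show thesis
  proof
    show "odd_p_group ?Q p"
      by (rule Q.odd_p_group_dvd[OF gQ]) (use card cQ Q.finite_carrier in \<open>simp_all add: order_def\<close>)
    show "group_hom G ?Q (h \<circ> (\<lambda>a. N #> a))" by fact
    show "(h \<circ> (\<lambda>a. N #> a)) ` carrier G = carrier ?Q"
      by (simp add: cQ carrier_FactGroup image_comp)
    show "card (carrier ?Q) * card N = card (carrier G)"
      using lagrange[OF N.subgroup_axioms] card by (simp add: FactGroup_def order_def)
    fix a assume a: "a \<in> carrier G"
    have "h (N #> a) = h \<one>\<^bsub>G Mod N\<^esub> \<longleftrightarrow> N #> a = \<one>\<^bsub>G Mod N\<^esub>"
      using inj_on_eq_iff[OF h f.hom_closed[OF a] Q.one_closed] .
    then show "(h \<circ> (\<lambda>a. N #> a)) a = \<one>\<^bsub>?Q\<^esub> \<longleftrightarrow> a \<in> N"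
      using N.Mod_eq_one_iff[OF a] by (simp add: image_group_one)
  qed
qed

end

section \<open>Elements of small order in powerful groups\<close>

text \<open>The gap of one between the exponents of \<open>a\<close> and \<open>b\<close> in the second and third clause is
  essential: in a powerful group an element of order \<open>p\<close> need not commute with arbitrary
  \<open>p\<close>-th powers. The three clauses are proved by one simultaneous induction on the group order,
  the third clause for a group using the second one for a proper quotient.\<close>

definition omega_laws :: "nat \<Rightarrow> ('a, 'b) monoid_scheme \<Rightarrow> bool" where
  "omega_laws p G \<longleftrightarrow>
    (\<forall>a\<in>carrier G. \<forall>b\<in>carrier G. a [^]\<^bsub>G\<^esub> p = \<one>\<^bsub>G\<^esub> \<longrightarrow> b [^]\<^bsub>G\<^esub> p = \<one>\<^bsub>G\<^esub> \<longrightarrow>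
       (a \<otimes>\<^bsub>G\<^esub> b) [^]\<^bsub>G\<^esub> p = \<one>\<^bsub>G\<^esub>) \<and>
    (\<forall>a\<in>carrier G. \<forall>b\<in>carrier G. a [^]\<^bsub>G\<^esub> (p ^ 2) = \<one>\<^bsub>G\<^esub> \<longrightarrow> b [^]\<^bsub>G\<^esub> p = \<one>\<^bsub>G\<^esub> \<longrightarrow>
       a [^]\<^bsub>G\<^esub> p \<otimes>\<^bsub>G\<^esub> b = b \<otimes>\<^bsub>G\<^esub> a [^]\<^bsub>G\<^esub> p) \<and>
    (\<forall>a\<in>carrier G. \<forall>b\<in>carrier G. a [^]\<^bsub>G\<^esub> (p ^ 3) = \<one>\<^bsub>G\<^esub> \<longrightarrow> b [^]\<^bsub>G\<^esub> (p ^ 2) = \<one>\<^bsub>G\<^esub> \<longrightarrow>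
       a [^]\<^bsub>G\<^esub> (p ^ 2) \<otimes>\<^bsub>G\<^esub> b = b \<otimes>\<^bsub>G\<^esub> a [^]\<^bsub>G\<^esub> (p ^ 2))"

lemma (in group) omega_laws_abelian:
  assumes "\<And>a b. a \<in> carrier G \<Longrightarrow> b \<in> carrier G \<Longrightarrow> a \<otimes> b = b \<otimes> a"
  shows "omega_laws p G"
proof -
  have "(a \<otimes> b) [^] p = \<one>"
    if "a \<in> carrier G" "b \<in> carrier G" "a [^] p = \<one>" "b [^] p = \<one>" for a b
    using pow_mult_distrib[OF assms[OF that(1,2)] that(1,2), of p] that by simp
  moreover have "a [^] n \<otimes> b = b \<otimes> a [^] n" if "a \<in> carrier G" "b \<in> carrier G" for a b and n :: nat
    using assms that nat_pow_closed by blast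
  ultimately show ?thesis unfolding omega_laws_def by blast
qed

lemma omega_lawsD1:
  assumes "omega_laws p G" "a \<in> carrier G" "b \<in> carrier G"
    "a [^]\<^bsub>G\<^esub> p = \<one>\<^bsub>G\<^esub>" "b [^]\<^bsub>G\<^esub> p = \<one>\<^bsub>G\<^esub>"
  shows "(a \<otimes>\<^bsub>G\<^esub> b) [^]\<^bsub>G\<^esub> p = \<one>\<^bsub>G\<^esub>"
  using assms unfolding omega_laws_def by blast

lemma omega_lawsD2:
  assumes "omega_laws p G" "a \<in> carrier G" "b \<in> carrier G"
    "a [^]\<^bsub>G\<^esub> (p ^ 2) = \<one>\<^bsub>G\<^esub>" "b [^]\<^bsub>G\<^esub> p = \<one>\<^bsub>G\<^esub>"
  shows "a [^]\<^bsub>G\<^esub> p \<otimes>\<^bsub>G\<^esub> b = b \<otimes>\<^bsub>G\<^esub> a [^]\<^bsub>G\<^esub> p"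
  using assms unfolding omega_laws_def by blast

lemma omega_lawsD3:
  assumes "omega_laws p G" "a \<in> carrier G" "b \<in> carrier G"
    "a [^]\<^bsub>G\<^esub> (p ^ 3) = \<one>\<^bsub>G\<^esub>" "b [^]\<^bsub>G\<^esub> (p ^ 2) = \<one>\<^bsub>G\<^esub>"
  shows "a [^]\<^bsub>G\<^esub> (p ^ 2) \<otimes>\<^bsub>G\<^esub> b = b \<otimes>\<^bsub>G\<^esub> a [^]\<^bsub>G\<^esub> (p ^ 2)"
  using assms unfolding omega_laws_def by blast

text \<open>For nonabelian \<open>G\<close>, the laws hold by induction in every
  \<open>adjoin_agemo x\<close> and in smaller quotients. From these the third law is derived for
  \<open>G\<close>, it yields the second, and the second yields the first.\<close>

lemma omega_laws_powerful:
  fixes G :: "nat monoid"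
  assumes "odd_p_group G p" "comm_powerful p G"
  shows "omega_laws p G"
  using assms
proof (induction "card (carrier G)" arbitrary: G rule: less_induct)
  case less
  interpret odd_p_group G p by fact
  note pw = less.prems(2)
  let ?A = "agemo p G (carrier G)"
  let ?B = "agemo p G ?A"
  let ?C = "agemo p G ?B"
  show ?case
  proof (cases "\<forall>a\<in>carrier G. \<forall>b\<in>carrier G. a \<otimes>\<^bsub>G\<^esub> b = b \<otimes>\<^bsub>G\<^esub> a")
    case True
    then show ?thesis by (intro omega_laws_abelian) blast
  next
    case nonabelian: False
    have e0: "powerfully_embedded p G (carrier G)" using pw by (rule comm_powerful_imp_embedded)
    have eA: "powerfully_embedded p G ?A" using e0 by (rule embedded_agemo)
    have eB: "powerfully_embedded p G ?B" using eA by (rule embedded_agemo)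
    \<comment> \<open>Depth in the series turns into divisibility: each further commutator lies one
      term deeper, and members of deeper terms have roots of higher order.\<close>
    have rootA: "\<exists>v\<in>carrier G. g = v [^]\<^bsub>G\<^esub> p" if "g \<in> ?A" for g
      using embedded_agemo_eq_powers[OF e0 that] .
    have rootB: "\<exists>v\<in>carrier G. g = v [^]\<^bsub>G\<^esub> (p ^ 2)" if g: "g \<in> ?B" for g
    proof -
      obtain w where w: "w \<in> ?A" "g = w [^]\<^bsub>G\<^esub> p" using embedded_agemo_eq_powers[OF eA g] by blast
      obtain v where "v \<in> carrier G" "w = v [^]\<^bsub>G\<^esub> p" using rootA[OF w(1)] by blast
      then show ?thesis using w by (auto simp: nat_pow_pow power2_eq_square)
    qed
    \<comment> \<open>Extracting only a p^2-th root keeps the root in \<open>?A\<close>, hence in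
      every \<open>adjoin_agemo x\<close>, where the third law is available by induction.\<close>
    have rootC: "\<exists>v\<in>?A. g = v [^]\<^bsub>G\<^esub> (p ^ 2)" if g: "g \<in> ?C" for g
    proof -
      obtain w where w: "w \<in> ?B" "g = w [^]\<^bsub>G\<^esub> p" using embedded_agemo_eq_powers[OF eB g] by blast
      obtain v where v: "v \<in> ?A" "w = v [^]\<^bsub>G\<^esub> p" using embedded_agemo_eq_powers[OF eA w(1)] by blast
      then have "v \<in> carrier G" using agemo_carrier_subset by blast
      then show ?thesis using v w by (auto simp: nat_pow_pow power2_eq_square)
    qed
    have commA: "commutator G a b \<in> ?A" if "a \<in> carrier G" "b \<in> carrier G" for a b
      using e0 that by (simp add: powerfully_embedded_def)
    have commB: "commutator G a b \<in> ?B" if "a \<in> ?A" "b \<in> carrier G" for a b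
      using eA that by (simp add: powerfully_embedded_def)
    have commC: "commutator G a b \<in> ?C" if "a \<in> ?B" "b \<in> carrier G" for a b
      using eB that by (simp add: powerfully_embedded_def)
    \<comment> \<open>By the first law in \<open>adjoin_agemo x\<close>, \<open>W x\<close> is a
      subgroup, and it is normal in \<open>G\<close>. Commutators with an element of
      \<open>W x\<close> therefore have order dividing \<open>p\<close>.\<close>
    define W where "W x = {m \<in> adjoin_agemo x. m [^]\<^bsub>G\<^esub> p = \<one>\<^bsub>G\<^esub>}" for x
    have MG: "m \<in> carrier G" if "x \<in> carrier G" "m \<in> adjoin_agemo x" for x m
      using subgroup.mem_carrier[OF adjoin_agemo_subgroup] that by blast
    have Mlaws: "omega_laws p (G\<lparr>carrier := adjoin_agemo x\<rparr>)" if x: "x \<in> carrier G" for x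
    proof (rule less.hyps)
      have "adjoin_agemo x \<noteq> carrier G"
        using nonabelian abelian_if_cyclic_mod_agemo[OF x] by blast
      then have "adjoin_agemo x \<subset> carrier G" using MG[OF x] by blast
      then show "card (carrier (G\<lparr>carrier := adjoin_agemo x\<rparr>)) < card (carrier G)"
        using finite_carrier by (simp add: psubset_card_mono)
      show "odd_p_group (G\<lparr>carrier := adjoin_agemo x\<rparr>) p"
        by (rule odd_p_group_subgroup[OF adjoin_agemo_subgroup[OF x]])
      show "comm_powerful p (G\<lparr>carrier := adjoin_agemo x\<rparr>)"
        by (rule adjoin_agemo_powerful[OF pw x])
    qed
    have WG: "W x \<lhd> G" if x: "x \<in> carrier G" for x
      unfolding W_def
    proof (rule order_p_normal[OF adjoin_agemo_normal[OF pw x]])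
      fix a b assume "a \<in> adjoin_agemo x" "b \<in> adjoin_agemo x"
        "a [^]\<^bsub>G\<^esub> p = \<one>\<^bsub>G\<^esub>" "b [^]\<^bsub>G\<^esub> p = \<one>\<^bsub>G\<^esub>"
      then show "(a \<otimes>\<^bsub>G\<^esub> b) [^]\<^bsub>G\<^esub> p = \<one>\<^bsub>G\<^esub>"
        using omega_lawsD1[OF Mlaws[OF x], of a b] by (simp flip: nat_pow_consistent)
    qed
    have inW: "x \<in> W x" if "x \<in> carrier G" "x [^]\<^bsub>G\<^esub> p = \<one>\<^bsub>G\<^esub>" for x
      using that by (auto simp: W_def intro: generate.incl)
    have Wp: "w [^]\<^bsub>G\<^esub> p = \<one>\<^bsub>G\<^esub>" "w \<in> carrier G" "w [^]\<^bsub>G\<^esub> (p ^ 2) = \<one>\<^bsub>G\<^esub>"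
      if "w \<in> W x" "x \<in> carrier G" for w x
    proof -
      show w: "w [^]\<^bsub>G\<^esub> p = \<one>\<^bsub>G\<^esub>" "w \<in> carrier G" using that MG by (auto simp: W_def)
      then show "w [^]\<^bsub>G\<^esub> (p ^ 2) = \<one>\<^bsub>G\<^esub>" by (simp add: power2_eq_square flip: nat_pow_pow)
    qed

    \<comment> \<open>Both g^(p^2) and x^p lie in \<open>W x\<close>. The second law in the quotient
      \<open>Q\<close> by \<open>W x\<close> then makes g^p and x commute modulo \<open>W x\<close>,
      so c = [g^p, x] has order dividing \<open>p\<close>.\<close>
    have T3: "g [^]\<^bsub>G\<^esub> (p ^ 2) \<otimes>\<^bsub>G\<^esub> x = x \<otimes>\<^bsub>G\<^esub> g [^]\<^bsub>G\<^esub> (p ^ 2)"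
      if g: "g \<in> carrier G" and x: "x \<in> carrier G"
        and gp: "g [^]\<^bsub>G\<^esub> (p ^ 3) = \<one>\<^bsub>G\<^esub>" and xp: "x [^]\<^bsub>G\<^esub> (p ^ 2) = \<one>\<^bsub>G\<^esub>" for g x
    proof -
      obtain Q :: "nat monoid" and f where Q: "odd_p_group Q p" "group_hom G Q f"
          "f ` carrier G = carrier Q"
          "\<And>a. a \<in> carrier G \<Longrightarrow> f a = \<one>\<^bsub>Q\<^esub> \<longleftrightarrow> a \<in> W x"
          "card (carrier Q) * card (W x) = card (carrier G)"
        using nat_quotient[OF WG[OF x]] by blast
      interpret f: group_hom G Q f by fact
      have xM: "x \<in> adjoin_agemo x" by (rule generate.incl) simp
      have AM: "?A \<subseteq> adjoin_agemo x" by (rule agemo_subset_adjoin)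
      have sM: "subgroup (adjoin_agemo x) G" by (rule adjoin_agemo_subgroup[OF x])
      have "omega_laws p Q"
      proof (rule less.hyps)
        show "odd_p_group Q p" by fact
        show "comm_powerful p Q" by (rule f.comm_powerful_image[OF Q(3) pw])
        \<comment> \<open>\<open>G\<close> is nonabelian, so \<open>?A\<close> contains a nontrivial
          commutator. A power of a nontrivial element of \<open>adjoin_agemo x\<close> has order
          \<open>p\<close>, so \<open>W x\<close> is nontrivial and \<open>Q\<close> is smaller than
          \<open>G\<close>.\<close>
        have "\<exists>m\<in>adjoin_agemo x. m \<noteq> \<one>\<^bsub>G\<^esub>"
        proof (rule ccontr)
          assume "\<not> ?thesis"
          then have "commutator G a b = \<one>\<^bsub>G\<^esub>" if "a \<in> carrier G" "b \<in> carrier G" for a b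
            using commA[OF that] AM by blast
          then show False using nonabelian commutator_eq_one_iff by blast
        qed
        then obtain m where m: "m \<in> adjoin_agemo x" "m \<noteq> \<one>\<^bsub>G\<^esub>" by blast
        obtain k where k: "m [^]\<^bsub>G\<^esub> (p ^ k) \<noteq> \<one>\<^bsub>G\<^esub>" "(m [^]\<^bsub>G\<^esub> (p ^ k)) [^]\<^bsub>G\<^esub> p = \<one>\<^bsub>G\<^esub>"
          using obtain_order_p[OF MG[OF x m(1)] m(2)] by blast
        have "m [^]\<^bsub>G\<^esub> (p ^ k) \<in> W x"
          using subgroup_nat_pow_closed[OF sM m(1)] k by (simp add: W_def)
        moreover have "\<one>\<^bsub>G\<^esub> \<in> W x" using subgroup.one_closed[OF normal_imp_subgroup[OF WG[OF x]]] .
        ultimately have "card {m [^]\<^bsub>G\<^esub> (p ^ k), \<one>\<^bsub>G\<^esub>} \<le> card (W x)"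
          using finite_subset[OF _ finite_carrier, of "W x"] Wp(2) x by (intro card_mono) auto
        then have "2 \<le> card (W x)" using k(1) by simp
        then have "card (carrier Q) * 2 \<le> card (carrier G)"
          unfolding Q(5)[symmetric] by (rule mult_le_mono2)
        moreover have "card (carrier G) > 0" using finite_carrier card_gt_0_iff by blast
        ultimately show "card (carrier Q) < card (carrier G)" by linarith
      qed
      have gpM: "g [^]\<^bsub>G\<^esub> p \<in> ?A" using g by (rule agemo_pow)
      have "g [^]\<^bsub>G\<^esub> (p ^ 2) \<in> W x"
      proof -
        have "(g [^]\<^bsub>G\<^esub> p) [^]\<^bsub>G\<^esub> p \<in> adjoin_agemo x"
          using subgroup_nat_pow_closed[OF sM] gpM AM by blast
        then show ?thesis using g gp
          by (simp add: W_def nat_pow_pow power2_eq_square power3_eq_cube)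
      qed
      moreover have "x [^]\<^bsub>G\<^esub> p \<in> W x"
        using subgroup_nat_pow_closed[OF sM xM] x xp by (simp add: W_def nat_pow_pow power2_eq_square)
      ultimately have "f g [^]\<^bsub>Q\<^esub> (p ^ 2) = \<one>\<^bsub>Q\<^esub>" "f x [^]\<^bsub>Q\<^esub> p = \<one>\<^bsub>Q\<^esub>"
        using Q(4) g x f.hom_nat_pow nat_pow_closed by metis+
      then have "f g [^]\<^bsub>Q\<^esub> p \<otimes>\<^bsub>Q\<^esub> f x = f x \<otimes>\<^bsub>Q\<^esub> f g [^]\<^bsub>Q\<^esub> p"
        using g x by (intro omega_lawsD2[OF \<open>omega_laws p Q\<close>]) simp_all
      then have "commutator Q (f (g [^]\<^bsub>G\<^esub> p)) (f x) = \<one>\<^bsub>Q\<^esub>"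
        using f.H.commutator_eq_one_iff[of "f (g [^]\<^bsub>G\<^esub> p)" "f x"] g x by (simp add: f.hom_nat_pow)
      then have "f (commutator G (g [^]\<^bsub>G\<^esub> p) x) = \<one>\<^bsub>Q\<^esub>"
        using g x by (simp add: f.hom_commutator)
      define n where "n = g [^]\<^bsub>G\<^esub> p"
      define c where "c = commutator G n x"
      define d where "d = commutator G c n"
      have n: "n \<in> carrier G" "n \<in> ?A" "n [^]\<^bsub>G\<^esub> (p ^ 2) = \<one>\<^bsub>G\<^esub>"
        using g gpM gp by (simp_all add: n_def nat_pow_pow power2_eq_square power3_eq_cube mult.assoc)
      have c: "c \<in> W x" "c \<in> ?B"
        using \<open>f _ = \<one>\<^bsub>Q\<^esub>\<close> Q(4)[of c] n x commB by (simp_all add: c_def n_def)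
      note cp = Wp[OF c(1) x]
      have d: "d \<in> W x" "d \<in> ?C"
        using commutator_normal(1)[OF WG[OF x] c(1) n(1)] commC[OF c(2) n(1)] by (simp_all add: d_def)
      note dp = Wp[OF d(1) x]
      \<comment> \<open>Since \<open>d\<close> has order dividing \<open>p\<close>, its root
        \<open>v\<close> satisfies v^(p^3) = 1. The third law in \<open>adjoin_agemo x\<close> now
        makes \<open>d\<close> commute with \<open>n\<close> and \<open>c\<close>, which is what the
        class two criterion asks for.\<close>
      obtain v where v: "v \<in> ?A" "d = v [^]\<^bsub>G\<^esub> (p ^ 2)" using rootC[OF d(2)] by blast
      have vc: "v \<in> carrier G" using v agemo_carrier_subset by blast
      have "v [^]\<^bsub>G\<^esub> (p ^ 3) = (v [^]\<^bsub>G\<^esub> (p ^ 2)) [^]\<^bsub>G\<^esub> p"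
        using vc by (simp add: nat_pow_pow power2_eq_square power3_eq_cube mult.assoc)
      then have vp: "v [^]\<^bsub>G\<^esub> (p ^ 3) = \<one>\<^bsub>G\<^esub>" using v dp by simp
      have comm_d: "d \<otimes>\<^bsub>G\<^esub> m = m \<otimes>\<^bsub>G\<^esub> d"
        if "m \<in> adjoin_agemo x" "m [^]\<^bsub>G\<^esub> (p ^ 2) = \<one>\<^bsub>G\<^esub>" for m
        using omega_lawsD3[OF Mlaws[OF x], of v m] that vp v AM
        by (auto simp flip: nat_pow_consistent)
      have "n [^]\<^bsub>G\<^esub> p \<otimes>\<^bsub>G\<^esub> x = x \<otimes>\<^bsub>G\<^esub> n [^]\<^bsub>G\<^esub> p"
      proof (rule commute_pow_of_class2[OF n(1) x odd_p c_def d_def])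
        show "d \<otimes>\<^bsub>G\<^esub> n = n \<otimes>\<^bsub>G\<^esub> d" using comm_d n AM by blast
        show "d \<otimes>\<^bsub>G\<^esub> c = c \<otimes>\<^bsub>G\<^esub> d" using comm_d c(1) cp by (simp add: W_def)
      qed (use cp dp in auto)
      then show ?thesis using g by (simp add: n_def nat_pow_pow power2_eq_square)
    qed

    \<comment> \<open>Both u = [x, y] and t = [u, x] inherit exponent \<open>p\<close> from the
      normal subgroup \<open>W y\<close>. As \<open>t\<close> lies in \<open>?B\<close> it is a
      p^2-th power, so \<open>T3\<close> makes it commute with \<open>x\<close> and
      \<open>u\<close>, both killed by p^2.\<close>
    have T2: "x [^]\<^bsub>G\<^esub> p \<otimes>\<^bsub>G\<^esub> y = y \<otimes>\<^bsub>G\<^esub> x [^]\<^bsub>G\<^esub> p"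
      if x: "x \<in> carrier G" and y: "y \<in> carrier G"
        and xp: "x [^]\<^bsub>G\<^esub> (p ^ 2) = \<one>\<^bsub>G\<^esub>" and yp: "y [^]\<^bsub>G\<^esub> p = \<one>\<^bsub>G\<^esub>" for x y
    proof -
      define u where "u = commutator G x y"
      define t where "t = commutator G u x"
      have u: "u \<in> W y" "u \<in> ?A"
        using commutator_normal(2)[OF WG[OF y] inW[OF y yp] x] commA x y by (simp_all add: u_def)
      note up = Wp[OF u(1) y]
      have t: "t \<in> W y" "t \<in> ?B"
        using commutator_normal(1)[OF WG[OF y] u(1) x] commB[OF u(2) x] by (simp_all add: t_def)
      note tp = Wp[OF t(1) y]
      obtain v where v: "v \<in> carrier G" "t = v [^]\<^bsub>G\<^esub> (p ^ 2)" using rootB[OF t(2)] by blast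
      have "v [^]\<^bsub>G\<^esub> (p ^ 3) = (v [^]\<^bsub>G\<^esub> (p ^ 2)) [^]\<^bsub>G\<^esub> p"
        using v by (simp add: nat_pow_pow power2_eq_square power3_eq_cube mult.assoc)
      then have vp: "v [^]\<^bsub>G\<^esub> (p ^ 3) = \<one>\<^bsub>G\<^esub>" using v tp by simp
      show ?thesis
      proof (rule commute_pow_of_class2[OF x y odd_p u_def t_def])
        show "t \<otimes>\<^bsub>G\<^esub> x = x \<otimes>\<^bsub>G\<^esub> t" using T3[OF v(1) x vp xp] v(2) by simp
        show "t \<otimes>\<^bsub>G\<^esub> u = u \<otimes>\<^bsub>G\<^esub> t" using T3[OF v(1) up(2) vp up(3)] v(2) by simp
      qed (use up tp in auto)
    qed

    \<comment> \<open>The commutator t = [b, a] lies in \<open>W a\<close> and is a p-th power v^p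
      with v^(p^2) = 1. By \<open>T2\<close> it commutes with \<open>a\<close> and \<open>b\<close>,
      so the class two formula applies.\<close>
    have T1: "(a \<otimes>\<^bsub>G\<^esub> b) [^]\<^bsub>G\<^esub> p = \<one>\<^bsub>G\<^esub>"
      if a: "a \<in> carrier G" and b: "b \<in> carrier G"
        and ap: "a [^]\<^bsub>G\<^esub> p = \<one>\<^bsub>G\<^esub>" and bp: "b [^]\<^bsub>G\<^esub> p = \<one>\<^bsub>G\<^esub>" for a b
    proof -
      define t where "t = commutator G b a"
      have t: "t \<in> W a" "t \<in> ?A"
        using commutator_normal(2)[OF WG[OF a] inW[OF a ap] b] commA a b by (simp_all add: t_def)
      note tp = Wp[OF t(1) a]
      obtain v where v: "v \<in> carrier G" "t = v [^]\<^bsub>G\<^esub> p" using rootA[OF t(2)] by blast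
      have vp: "v [^]\<^bsub>G\<^esub> (p ^ 2) = \<one>\<^bsub>G\<^esub>"
        using v tp(1) by (simp add: nat_pow_pow power2_eq_square)
      have "(a \<otimes>\<^bsub>G\<^esub> b) [^]\<^bsub>G\<^esub> p = a [^]\<^bsub>G\<^esub> p \<otimes>\<^bsub>G\<^esub> b [^]\<^bsub>G\<^esub> p \<otimes>\<^bsub>G\<^esub> t [^]\<^bsub>G\<^esub> (p choose 2)"
      proof (rule pow_mult_class2[OF a b tp(2)])
        show "b \<otimes>\<^bsub>G\<^esub> a = a \<otimes>\<^bsub>G\<^esub> b \<otimes>\<^bsub>G\<^esub> t" unfolding t_def by (rule mult_eq_commutator[OF b a])
        show "t \<otimes>\<^bsub>G\<^esub> a = a \<otimes>\<^bsub>G\<^esub> t" using T2[OF v(1) a vp ap] v(2) by simp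
        show "t \<otimes>\<^bsub>G\<^esub> b = b \<otimes>\<^bsub>G\<^esub> t" using T2[OF v(1) b vp bp] v(2) by simp
      qed
      then show ?thesis using ap bp pow_odd_choose_two[OF tp(2,1) odd_p] by simp
    qed
    show ?thesis unfolding omega_laws_def using T1 T2 T3 by blast
  qed
qed

text \<open>Dividing by the subgroup of elements of order dividing \<open>p\<close> lowers the
  exponent for \<open>y\<close> by one. The quotient then shows that \<open>[x, y]^(p^k)\<close>
  lies in that subgroup, and one more p-th power kills it.\<close>

lemma commutator_pow_eq_one:
  fixes G :: "nat monoid"
  assumes "odd_p_group G p" "comm_powerful p G" "x \<in> carrier G" "y \<in> carrier G"
    "y [^]\<^bsub>G\<^esub> (p ^ k) = \<one>\<^bsub>G\<^esub>"
  shows "commutator G x y [^]\<^bsub>G\<^esub> (p ^ k) = \<one>\<^bsub>G\<^esub>"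
  using assms
proof (induction k arbitrary: G x y)
  case 0
  interpret odd_p_group G p by fact
  show ?case using 0 by (simp add: commutator_eq_one_iff)
next
  case (Suc k)
  interpret odd_p_group G p by fact
  note x = \<open>x \<in> carrier G\<close> and y = \<open>y \<in> carrier G\<close>
  let ?W = "{m \<in> carrier G. m [^]\<^bsub>G\<^esub> p = \<one>\<^bsub>G\<^esub>}"
  have "?W \<lhd> G"
    by (rule order_p_normal[OF normal_self])
       (rule omega_lawsD1[OF omega_laws_powerful[OF Suc.prems(1,2)]])
  then obtain Q :: "nat monoid" and f where Q: "odd_p_group Q p" "group_hom G Q f"
      "f ` carrier G = carrier Q" "\<And>a. a \<in> carrier G \<Longrightarrow> f a = \<one>\<^bsub>Q\<^esub> \<longleftrightarrow> a \<in> ?W"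
      "card (carrier Q) * card ?W = card (carrier G)"
    by (rule nat_quotient) (rule that)
  interpret f: group_hom G Q f by fact
  have "y [^]\<^bsub>G\<^esub> (p ^ k) \<in> ?W"
    using Suc.prems(5) y by (simp add: nat_pow_pow mult.commute)
  then have "f y [^]\<^bsub>Q\<^esub> (p ^ k) = \<one>\<^bsub>Q\<^esub>"
    using Q(4)[of "y [^]\<^bsub>G\<^esub> (p ^ k)"] y by (simp add: f.hom_nat_pow)
  then have "commutator Q (f x) (f y) [^]\<^bsub>Q\<^esub> (p ^ k) = \<one>\<^bsub>Q\<^esub>"
    using x y by (intro Suc.IH[OF Q(1) f.comm_powerful_image[OF Q(3) Suc.prems(2)]]) simp_all
  then have "f (commutator G x y [^]\<^bsub>G\<^esub> (p ^ k)) = \<one>\<^bsub>Q\<^esub>"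
    using x y by (simp add: f.hom_nat_pow f.hom_commutator)
  then have "commutator G x y [^]\<^bsub>G\<^esub> (p ^ k) \<in> ?W"
    using Q(4)[of "commutator G x y [^]\<^bsub>G\<^esub> (p ^ k)"] x y by simp
  then show ?case using x y by (simp add: nat_pow_pow mult.commute)
qed

section \<open>Embedding a quasi-powerful group in a powerful group\<close>

lemma (in group) group_center_subgroup: "subgroup (group_center G) G"
  unfolding group_center_def by (rule centralizer_subgroup) simp

lemma (in group) group_center_commute:
  "z \<in> group_center G \<Longrightarrow> g \<in> carrier G \<Longrightarrow> z \<otimes> g = g \<otimes> z"
  by (simp add: group_center_def)

lemma (in group) group_center_carrier: "z \<in> group_center G \<Longrightarrow> z \<in> carrier G"
  by (simp add: group_center_def)

lemma (in group) group_center_normal: "group_center G \<lhd> G"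
proof (rule normal_invI[OF group_center_subgroup])
  fix x h assume x: "x \<in> carrier G" and h: "h \<in> group_center G"
  have hc: "h \<in> carrier G" by (rule group_center_carrier[OF h])
  have "x \<otimes> h \<otimes> inv x = h \<otimes> x \<otimes> inv x" by (simp only: group_center_commute[OF h x])
  also have "\<dots> = h" using x hc by (simp add: m_assoc)
  finally show "x \<otimes> h \<otimes> inv x \<in> group_center G" using h by simp
qed

lemma (in group) commutator_mult_central:
  assumes "a \<in> carrier G" "b \<in> carrier G" "e \<in> group_center G" "f \<in> group_center G"
  shows "commutator G (a \<otimes> e) (b \<otimes> f) = commutator G a b"
proof -
  let ?c = "commutator G a b"
  have c: "e \<in> carrier G" "f \<in> carrier G" "?c \<in> carrier G"
    using assms group_center_carrier by auto
  note e = group_center_commute[OF assms(3)] and f = group_center_commute[OF assms(4)]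
  have "a \<otimes> e \<otimes> (b \<otimes> f) = a \<otimes> (e \<otimes> b) \<otimes> f"
    using assms(1,2) c by (simp add: m_assoc)
  also have "\<dots> = (a \<otimes> b) \<otimes> (e \<otimes> f)"
    using assms(1,2) c by (simp add: e m_assoc)
  also have "\<dots> = b \<otimes> a \<otimes> ?c \<otimes> (e \<otimes> f)"
    by (simp only: mult_eq_commutator[OF assms(1,2)])
  also have "\<dots> = b \<otimes> (a \<otimes> ((?c \<otimes> e) \<otimes> f))"
    using assms(1,2) c by (simp add: m_assoc)
  also have "\<dots> = b \<otimes> (a \<otimes> ((e \<otimes> ?c) \<otimes> f))"
    by (simp only: e[OF c(3)])
  also have "\<dots> = b \<otimes> ((a \<otimes> (e \<otimes> ?c)) \<otimes> f)"
    using assms(1,2) c by (simp add: m_assoc)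
  also have "\<dots> = b \<otimes> (f \<otimes> (a \<otimes> (e \<otimes> ?c)))"
    using f[of "a \<otimes> (e \<otimes> ?c)"] assms(1,2) c by simp
  also have "\<dots> = (b \<otimes> f \<otimes> (a \<otimes> e)) \<otimes> ?c"
    using assms(1,2) c by (simp add: m_assoc)
  finally have "b \<otimes> f \<otimes> (a \<otimes> e) \<otimes> commutator G (a \<otimes> e) (b \<otimes> f) = b \<otimes> f \<otimes> (a \<otimes> e) \<otimes> ?c"
    using mult_eq_commutator[of "a \<otimes> e" "b \<otimes> f"] assms(1,2) c by simp
  then show ?thesis using assms(1,2) c by simp
qed

text \<open>The pair \<open>(g, i)\<close> stands for \<open>g \<cdot> r\<^sup>i\<close>, where \<open>r\<close> is a new central element with \<open>r\<^sup>p = z\<close>.\<close>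

definition adjoin_root :: "nat \<Rightarrow> ('a, 'b) monoid_scheme \<Rightarrow> 'a \<Rightarrow> ('a \<times> nat) monoid" where
  "adjoin_root p G z = \<lparr>carrier = carrier G \<times> {..<p},
     monoid.mult = (\<lambda>(g, i) (h, j). (g \<otimes>\<^bsub>G\<^esub> h \<otimes>\<^bsub>G\<^esub> z [^]\<^bsub>G\<^esub> ((i + j) div p), (i + j) mod p)),
     one = (\<one>\<^bsub>G\<^esub>, 0)\<rparr>"

lemma carrier_adjoin_root: "carrier (adjoin_root p G z) = carrier G \<times> {..<p}"
  by (simp add: adjoin_root_def)

lemma mult_adjoin_root:
  "(g, i) \<otimes>\<^bsub>adjoin_root p G z\<^esub> (h, j) =
     (g \<otimes>\<^bsub>G\<^esub> h \<otimes>\<^bsub>G\<^esub> z [^]\<^bsub>G\<^esub> ((i + j) div p), (i + j) mod p)"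
  by (simp add: adjoin_root_def)

lemma one_adjoin_root: "\<one>\<^bsub>adjoin_root p G z\<^esub> = (\<one>\<^bsub>G\<^esub>, 0)"
  by (simp add: adjoin_root_def)

lemma (in group) group_adjoin_root:
  assumes z: "z \<in> group_center G" and p: "p > 0"
  shows "group (adjoin_root p G z)"
proof (rule groupI)
  have zc: "z \<in> carrier G" by (rule group_center_carrier[OF z])
  have zn: "z [^] n \<otimes> g = g \<otimes> z [^] n" if "g \<in> carrier G" for n :: nat and g
    by (rule commute_pow[OF zc that group_center_commute[OF z that]])
  show "x \<otimes>\<^bsub>adjoin_root p G z\<^esub> y \<in> carrier (adjoin_root p G z)"
    if "x \<in> carrier (adjoin_root p G z)" "y \<in> carrier (adjoin_root p G z)" for x y
    using that zc p by (cases x; cases y) (simp add: carrier_adjoin_root mult_adjoin_root)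
  show "\<one>\<^bsub>adjoin_root p G z\<^esub> \<in> carrier (adjoin_root p G z)"
    using p by (simp add: carrier_adjoin_root one_adjoin_root)
  fix x assume "x \<in> carrier (adjoin_root p G z)"
  then obtain g i where x: "x = (g, i)" and g: "g \<in> carrier G" and i: "i < p"
    by (auto simp: carrier_adjoin_root)
  show "\<one>\<^bsub>adjoin_root p G z\<^esub> \<otimes>\<^bsub>adjoin_root p G z\<^esub> x = x"
    using x g i by (simp add: one_adjoin_root mult_adjoin_root)
  show "\<exists>y\<in>carrier (adjoin_root p G z). y \<otimes>\<^bsub>adjoin_root p G z\<^esub> x = \<one>\<^bsub>adjoin_root p G z\<^esub>"
  proof (cases "i = 0")
    case True
    then have "(inv g, 0) \<otimes>\<^bsub>adjoin_root p G z\<^esub> x = \<one>\<^bsub>adjoin_root p G z\<^esub>"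
      using x g by (simp add: one_adjoin_root mult_adjoin_root)
    then show ?thesis using g p by (intro bexI[of _ "(inv g, 0)"]) (simp_all add: carrier_adjoin_root)
  next
    case False
    \<comment> \<open>The inverse of g r^i is g^-1 r^(-i) = z^-1 g^-1 r^(p - i), because r^p = z is
      central; here \<open>p - i\<close> is below \<open>p\<close> as \<open>i\<close> is not
      0.\<close>
    have "inv z \<otimes> inv g \<otimes> g \<otimes> z = \<one>" using g zc by (simp add: m_assoc)
    then have "(inv z \<otimes> inv g, p - i) \<otimes>\<^bsub>adjoin_root p G z\<^esub> x = \<one>\<^bsub>adjoin_root p G z\<^esub>"
      using x i zc p by (simp add: one_adjoin_root mult_adjoin_root)
    then show ?thesis using g zc p False
      by (intro bexI[of _ "(inv z \<otimes> inv g, p - i)"]) (simp_all add: carrier_adjoin_root)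
  qed
  fix y w assume "y \<in> carrier (adjoin_root p G z)" "w \<in> carrier (adjoin_root p G z)"
  then obtain h j k l where y: "y = (h, j)" "h \<in> carrier G" "j < p"
    and w: "w = (k, l)" "k \<in> carrier G" "l < p"
    by (auto simp: carrier_adjoin_root)
  let ?a = "(i + j) div p" and ?b = "((i + j) mod p + l) div p"
    and ?c = "(j + l) div p" and ?d = "(i + (j + l) mod p) div p"
  \<comment> \<open>Both bracketings carry the same total number of factors \<open>z\<close>, namely
    (i + j + l) div p.\<close>
  have ab: "?a + ?b = ?c + ?d"
  proof -
    have carry: "m div p + (m mod p + n) div p = (m + n) div p" for m n
    proof -
      have "(m + n) div p = (m mod p + n + p * (m div p)) div p"
        by (rule arg_cong[of _ _ "\<lambda>q. q div p"]) simp
      also have "\<dots> = m div p + (m mod p + n) div p"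
        using p by (intro div_mult_self2) simp
      finally show ?thesis by simp
    qed
    show ?thesis using carry[of "i + j" l] carry[of "j + l" i] by (simp add: ac_simps)
  qed
  have "g \<otimes> h \<otimes> z [^] ?a \<otimes> k \<otimes> z [^] ?b = g \<otimes> h \<otimes> (z [^] ?a \<otimes> k) \<otimes> z [^] ?b"
    using g y w zc by (simp add: m_assoc)
  also have "\<dots> = g \<otimes> h \<otimes> k \<otimes> z [^] (?a + ?b)"
    using g y w zc zn[OF w(2)] by (simp add: m_assoc nat_pow_mult)
  also have "\<dots> = g \<otimes> (h \<otimes> k \<otimes> z [^] ?c) \<otimes> z [^] ?d"
    unfolding ab using g y w zc by (simp add: m_assoc nat_pow_mult)
  finally show "x \<otimes>\<^bsub>adjoin_root p G z\<^esub> y \<otimes>\<^bsub>adjoin_root p G z\<^esub> w =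
      x \<otimes>\<^bsub>adjoin_root p G z\<^esub> (y \<otimes>\<^bsub>adjoin_root p G z\<^esub> w)"
    using x y w by (simp add: mult_adjoin_root mod_add_left_eq mod_add_right_eq add.assoc)
qed

text \<open>An embedding of \<open>G\<close> with H = \<phi>(G) Z(H). Central factors do not affect
  commutators, so every commutator of \<open>H\<close> is the image of one of
  \<open>G\<close>.\<close>

definition central_overgroup ::
  "nat \<Rightarrow> ('a, 'b) monoid_scheme \<Rightarrow> ('c, 'd) monoid_scheme \<Rightarrow> ('a \<Rightarrow> 'c) \<Rightarrow> bool" where
  "central_overgroup p G H \<phi> \<longleftrightarrow>
     odd_p_group H p \<and> group_hom G H \<phi> \<and> inj_on \<phi> (carrier G) \<and>
     (\<forall>x\<in>carrier H. \<exists>g\<in>carrier G. \<exists>e\<in>group_center H. x = \<phi> g \<otimes>\<^bsub>H\<^esub> e)"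

lemma central_overgroup_decompose:
  assumes "central_overgroup p G H \<phi>" "x \<in> carrier H"
  obtains g e where "g \<in> carrier G" "e \<in> group_center H" "x = \<phi> g \<otimes>\<^bsub>H\<^esub> e"
  using assms unfolding central_overgroup_def by blast

text \<open>The image commutes with \<phi>(G) and with Z(H), which together make up
  \<open>H\<close>. Central elements thus stay central while roots are adjoined one after
  another.\<close>

lemma central_overgroup_center:
  assumes H: "central_overgroup p G H \<phi>" and z: "z \<in> group_center G"
  shows "\<phi> z \<in> group_center H"
proof -
  interpret group_hom G H \<phi> using H by (simp add: central_overgroup_def)
  have zc: "z \<in> carrier G" by (rule G.group_center_carrier[OF z])
  have "\<phi> z \<otimes>\<^bsub>H\<^esub> x = x \<otimes>\<^bsub>H\<^esub> \<phi> z" if xH: "x \<in> carrier H" for x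
  proof -
    obtain g e where g: "g \<in> carrier G" and e: "e \<in> group_center H" and x: "x = \<phi> g \<otimes>\<^bsub>H\<^esub> e"
      by (rule central_overgroup_decompose[OF H xH])
    have ec: "e \<in> carrier H" by (rule H.group_center_carrier[OF e])
    have "\<phi> z \<otimes>\<^bsub>H\<^esub> x = \<phi> (z \<otimes>\<^bsub>G\<^esub> g) \<otimes>\<^bsub>H\<^esub> e" using x zc g ec by (simp add: H.m_assoc)
    also have "\<dots> = \<phi> g \<otimes>\<^bsub>H\<^esub> (\<phi> z \<otimes>\<^bsub>H\<^esub> e)"
      using zc g ec by (simp add: G.group_center_commute[OF z g] H.m_assoc)
    also have "\<dots> = x \<otimes>\<^bsub>H\<^esub> \<phi> z"
      using x zc g ec H.group_center_commute[OF e, of "\<phi> z"] by (simp add: H.m_assoc)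
    finally show ?thesis .
  qed
  then show ?thesis using zc by (simp add: group_center_def)
qed

lemma central_overgroup_trans:
  assumes H: "central_overgroup p G H \<phi>" and K: "central_overgroup p H K \<psi>"
  shows "central_overgroup p G K (\<psi> \<circ> \<phi>)"
proof -
  interpret f: group_hom G H \<phi> using H by (simp add: central_overgroup_def)
  interpret g: group_hom H K \<psi> using K by (simp add: central_overgroup_def)
  have "group_hom G K (\<psi> \<circ> \<phi>)"
    using Group.hom_compose[OF f.homh g.homh]
    by (simp add: group_hom_def group_hom_axioms_def f.G.is_group g.H.is_group)
  moreover have "inj_on (\<psi> \<circ> \<phi>) (carrier G)"
    using H K f.hom_closed by (auto simp: central_overgroup_def inj_on_def)
  moreover have "\<exists>g\<in>carrier G. \<exists>e\<in>group_center K. x = (\<psi> \<circ> \<phi>) g \<otimes>\<^bsub>K\<^esub> e" if x: "x \<in> carrier K" for x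
  proof -
    obtain h e where h: "h \<in> carrier H" "e \<in> group_center K" "x = \<psi> h \<otimes>\<^bsub>K\<^esub> e"
      by (rule central_overgroup_decompose[OF K x])
    obtain g d where g: "g \<in> carrier G" "d \<in> group_center H" "h = \<phi> g \<otimes>\<^bsub>H\<^esub> d"
      by (rule central_overgroup_decompose[OF H h(1)])
    have d: "\<psi> d \<in> group_center K" by (rule central_overgroup_center[OF K g(2)])
    have "x = (\<psi> \<circ> \<phi>) g \<otimes>\<^bsub>K\<^esub> (\<psi> d \<otimes>\<^bsub>K\<^esub> e)"
      using h g f.H.group_center_carrier[OF g(2)] g.H.group_center_carrier[OF h(2)]
      by (simp add: g.H.m_assoc)
    moreover have "\<psi> d \<otimes>\<^bsub>K\<^esub> e \<in> group_center K"
      by (rule subgroup.m_closed[OF g.H.group_center_subgroup d h(2)])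
    ultimately show ?thesis using g(1) by blast
  qed
  ultimately show ?thesis using K by (simp add: central_overgroup_def)
qed

section \<open>Adjoining p-th roots of central elements\<close>

context odd_p_group
begin

text \<open>The quotient by the trivial subgroup is a copy of \<open>G\<close> on the natural
  numbers. Returning to this type after each root keeps the type fixed however many roots are
  adjoined.\<close>

lemma nat_central_overgroup:
  obtains H :: "nat monoid" and \<phi> where "central_overgroup p G H \<phi>"
proof -
  obtain Q :: "nat monoid" and f where Q: "odd_p_group Q p" "group_hom G Q f" "f ` carrier G = carrier Q"
      "\<And>a. a \<in> carrier G \<Longrightarrow> f a = \<one>\<^bsub>Q\<^esub> \<longleftrightarrow> a \<in> {\<one>}"
      "card (carrier Q) * card {\<one>} = card (carrier G)"
    using nat_quotient[OF one_is_normal] by blast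
  interpret f: group_hom G Q f by fact
  have "inj_on f (carrier G)" using Q(4) by (simp add: f.inj_on_one_iff)
  moreover have "\<exists>g\<in>carrier G. \<exists>e\<in>group_center Q. x = f g \<otimes>\<^bsub>Q\<^esub> e" if x: "x \<in> carrier Q" for x
  proof -
    obtain g where g: "g \<in> carrier G" "x = f g" using x Q(3) by (metis imageE)
    have "\<one>\<^bsub>Q\<^esub> \<in> group_center Q" by (rule subgroup.one_closed[OF f.H.group_center_subgroup])
    then show ?thesis using g by (metis f.H.r_one f.hom_closed)
  qed
  ultimately have "central_overgroup p G Q f" using Q(1,2) by (simp add: central_overgroup_def)
  then show thesis by (rule that)
qed

lemma central_overgroup_adjoin_root:
  assumes z: "z \<in> group_center G"
  shows "central_overgroup p G (adjoin_root p G z) (\<lambda>g. (g, 0))"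
    and "\<exists>e\<in>carrier (adjoin_root p G z). (z, 0) = e [^]\<^bsub>adjoin_root p G z\<^esub> p"
proof -
  let ?H = "adjoin_root p G z"
  have p: "p > 1" by (rule prime_gt_1_nat[OF prime_p])
  have zc: "z \<in> carrier G" by (rule group_center_carrier[OF z])
  interpret H: group ?H by (rule group_adjoin_root[OF z]) (use p in simp)
  have "odd_p_group ?H p"
  proof -
    obtain n where "order G = p ^ n" using order_pow by blast
    then have "order ?H = p ^ Suc n" by (simp add: order_def carrier_adjoin_root card_cartesian_product)
    then have "\<exists>n. order ?H = p ^ n" by blast
    then show ?thesis using finite_carrier prime_p odd_p H.group_axioms
      by (simp add: odd_p_group_def odd_p_group_axioms_def carrier_adjoin_root)
  qed
  moreover have "group_hom G ?H (\<lambda>g. (g, 0))"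
    using p by (auto simp: group_hom_def group_hom_axioms_def hom_def carrier_adjoin_root
        mult_adjoin_root H.group_axioms group_axioms)
  moreover have "\<exists>g\<in>carrier G. \<exists>e\<in>group_center ?H. x = (g, 0) \<otimes>\<^bsub>?H\<^esub> e" if xH: "x \<in> carrier ?H" for x
  proof -
    obtain g i where x: "x = (g, i)" "g \<in> carrier G" "i < p"
      using xH by (auto simp: carrier_adjoin_root)
    have "(\<one>, i) \<in> group_center ?H"
      using x p by (auto simp: group_center_def carrier_adjoin_root mult_adjoin_root add.commute)
    moreover have "x = (g, 0) \<otimes>\<^bsub>?H\<^esub> (\<one>, i)" using x by (simp add: mult_adjoin_root)
    ultimately show ?thesis using x by blast
  qed
  ultimately show "central_overgroup p G ?H (\<lambda>g. (g, 0))"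
    by (auto simp: central_overgroup_def inj_on_def)
  \<comment> \<open>The new root is \<open>(\<one>, 1)\<close>. Its powers show no carry below
    \<open>p\<close>; the last multiplication carries once and produces
    \<open>(z, 0)\<close>.\<close>
  have pw: "n < p \<Longrightarrow> (\<one>, 1) [^]\<^bsub>?H\<^esub> n = (\<one>, n)" for n :: nat
    by (induction n) (simp_all add: one_adjoin_root mult_adjoin_root)
  have "(\<one>, 1) [^]\<^bsub>?H\<^esub> Suc (p - 1) = (\<one>, p - 1) \<otimes>\<^bsub>?H\<^esub> (\<one>, 1)"
    using pw[of "p - 1"] p by (simp only: H.nat_pow_Suc)
  also have "\<dots> = (z, 0)"
    using p zc by (simp add: mult_adjoin_root)
  finally have "(\<one>, 1) [^]\<^bsub>?H\<^esub> Suc (p - 1) = (z, 0)" .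
  then show "\<exists>e\<in>carrier ?H. (z, 0) = e [^]\<^bsub>?H\<^esub> p"
    using p by (intro bexI[of _ "(\<one>, 1)"]) (simp_all add: carrier_adjoin_root)
qed

text \<open>One root is adjoined per element of \<open>S\<close>; homomorphisms carry the roots
  found earlier into the larger group.\<close>

lemma adjoin_central_roots:
  assumes "finite S" "S \<subseteq> group_center G"
  shows "\<exists>(H :: nat monoid) \<phi>. central_overgroup p G H \<phi> \<and>
    (\<forall>s\<in>S. \<exists>e\<in>carrier H. \<phi> s = e [^]\<^bsub>H\<^esub> p)"
  using assms
proof (induction S rule: finite_induct)
  case empty
  then show ?case using nat_central_overgroup by (metis empty_iff)
next
  case (insert z S)
  then obtain H :: "nat monoid" and \<phi> where H: "central_overgroup p G H \<phi>"
    and S: "\<forall>s\<in>S. \<exists>e\<in>carrier H. \<phi> s = e [^]\<^bsub>H\<^esub> p" by auto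
  interpret H: odd_p_group H p using H by (simp add: central_overgroup_def)
  let ?z = "\<phi> z"
  let ?K = "adjoin_root p H ?z"
  have z: "?z \<in> group_center H" using central_overgroup_center[OF H] insert.prems by blast
  have K: "central_overgroup p H ?K (\<lambda>g. (g, 0))" by (rule H.central_overgroup_adjoin_root(1)[OF z])
  interpret K: odd_p_group ?K p using K by (simp add: central_overgroup_def)
  obtain L :: "nat monoid" and \<theta> where L: "central_overgroup p ?K L \<theta>"
    by (rule K.nat_central_overgroup)
  let ?f = "\<theta> \<circ> (\<lambda>g. (g, 0))"
  have HL: "central_overgroup p H L ?f" by (rule central_overgroup_trans[OF K L])
  interpret t: group_hom ?K L \<theta> using L by (simp add: central_overgroup_def)
  interpret f: group_hom H L ?f using HL by (simp add: central_overgroup_def)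
  have "\<exists>e\<in>carrier L. (?f \<circ> \<phi>) s = e [^]\<^bsub>L\<^esub> p" if "s \<in> insert z S" for s
  proof (cases "s = z")
    case True
    obtain e where e: "e \<in> carrier ?K" "(?z, 0) = e [^]\<^bsub>?K\<^esub> p"
      using H.central_overgroup_adjoin_root(2)[OF z] by blast
    then have "(?f \<circ> \<phi>) s = \<theta> e [^]\<^bsub>L\<^esub> p" using True t.hom_nat_pow[OF e(1)] by simp
    then show ?thesis using t.hom_closed[OF e(1)] by blast
  next
    case False
    then obtain e where e: "e \<in> carrier H" "\<phi> s = e [^]\<^bsub>H\<^esub> p" using S \<open>s \<in> insert z S\<close> by blast
    then have "(?f \<circ> \<phi>) s = ?f e [^]\<^bsub>L\<^esub> p" using f.hom_nat_pow[OF e(1)] by simp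
    then show ?thesis using f.hom_closed[OF e(1)] by blast
  qed
  moreover have "central_overgroup p G L (?f \<circ> \<phi>)" by (rule central_overgroup_trans[OF H HL])
  ultimately show ?case by blast
qed

lemma commutator_quasi_powerful:
  assumes qp: "quasi_powerful p G" and ab: "a \<in> carrier G" "b \<in> carrier G"
  shows "\<exists>w\<in>agemo p G (carrier G). \<exists>z\<in>group_center G. commutator G a b = w \<otimes> z"
proof -
  let ?Z = "group_center G"
  interpret Z: normal ?Z G by (rule group_center_normal)
  interpret f: group_hom G "G Mod ?Z" "\<lambda>a. ?Z #> a" by (rule Z.group_hom_Mod)
  let ?Q = "G Mod ?Z"
  let ?c = "commutator G a b"
  have sur: "(\<lambda>a. ?Z #> a) ` carrier G = carrier ?Q" by (simp add: carrier_FactGroup)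
  \<comment> \<open>The set \<open>derived\<close> is generated by the elements h k h^-1 k^-1.
    Taking h and k to be the inverses of the images of \<open>a\<close> and \<open>b\<close> matches
    the convention of \<open>commutator\<close>.\<close>
  let ?x = "inv\<^bsub>?Q\<^esub> (?Z #> a)" and ?y = "inv\<^bsub>?Q\<^esub> (?Z #> b)"
  have xy: "?x \<in> carrier ?Q" "?y \<in> carrier ?Q" using f.hom_closed ab by blast+
  have "?Z #> ?c = ?x \<otimes>\<^bsub>?Q\<^esub> ?y \<otimes>\<^bsub>?Q\<^esub> inv\<^bsub>?Q\<^esub> ?x \<otimes>\<^bsub>?Q\<^esub> inv\<^bsub>?Q\<^esub> ?y"
    using f.hom_commutator[OF ab] f.H.inv_inv f.hom_closed ab by (simp add: commutator_def)
  also have "\<dots> \<in> derived ?Q (carrier ?Q)"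
    unfolding derived_def by (rule generate.incl) (use xy in blast)
  also have "\<dots> \<subseteq> agemo p ?Q (carrier ?Q)"
    using qp by (simp add: quasi_powerful_def powerful_def pth_powers_subgroup_def agemo_def Setcompr_eq_image)
  also have "\<dots> = (\<lambda>a. ?Z #> a) ` agemo p G (carrier G)"
    by (simp only: f.agemo_img[OF subset_refl] sur)
  finally obtain w where w: "w \<in> agemo p G (carrier G)" "?Z #> ?c = ?Z #> w" by blast
  have wc: "w \<in> carrier G" using w agemo_carrier_subset by blast
  have "?Z #> (inv w \<otimes> ?c) = \<one>\<^bsub>?Q\<^esub>"
    using w wc ab f.hom_mult[of "inv w" ?c] f.hom_inv[of w] f.hom_closed[of w] f.H.l_inv
    by (simp del: one_FactGroup mult_FactGroup)
  then have "inv w \<otimes> ?c \<in> ?Z"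
    by (rule iffD1[OF Z.Mod_eq_one_iff, rotated]) (use wc ab in simp)
  moreover have "?c = w \<otimes> (inv w \<otimes> ?c)" using wc ab by (simp flip: m_assoc)
  ultimately show ?thesis using w by blast
qed

text \<open>A commutator of \<open>H\<close> is \<phi>([a, b]) = \<phi>(w) \<phi>(z) with w in G^p
  and z in Z(G). The first factor lies in H^p as an image of w, the second is a p-th power because a
  root of it was adjoined.\<close>

lemma powerful_central_overgroup:
  assumes qp: "quasi_powerful p G"
  obtains H :: "nat monoid" and \<phi> where "central_overgroup p G H \<phi>" "comm_powerful p H"
proof -
  have "finite (group_center G)"
    using finite_carrier group_center_carrier by (meson finite_subset subsetI)
  then obtain H :: "nat monoid" and \<phi> where H: "central_overgroup p G H \<phi>"
    and root: "\<forall>s\<in>group_center G. \<exists>e\<in>carrier H. \<phi> s = e [^]\<^bsub>H\<^esub> p"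
    using adjoin_central_roots by blast
  interpret H: odd_p_group H p using H by (simp add: central_overgroup_def)
  interpret f: group_hom G H \<phi> using H by (simp add: central_overgroup_def)
  let ?A = "agemo p H (carrier H)"
  have A: "subgroup ?A H" by (rule H.agemo_subgroup) simp
  have "commutator H x y \<in> ?A" if xy: "x \<in> carrier H" "y \<in> carrier H" for x y
  proof -
    obtain a d where x: "a \<in> carrier G" "d \<in> group_center H" "x = \<phi> a \<otimes>\<^bsub>H\<^esub> d"
      by (rule central_overgroup_decompose[OF H xy(1)])
    obtain b e where y: "b \<in> carrier G" "e \<in> group_center H" "y = \<phi> b \<otimes>\<^bsub>H\<^esub> e"
      by (rule central_overgroup_decompose[OF H xy(2)])
    obtain w z where wz: "w \<in> agemo p G (carrier G)" "z \<in> group_center G" "commutator G a b = w \<otimes> z"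
      using commutator_quasi_powerful[OF qp x(1) y(1)] by blast
    have c: "w \<in> carrier G" "z \<in> carrier G"
      using wz agemo_carrier_subset group_center_carrier by auto
    have "commutator H x y = \<phi> w \<otimes>\<^bsub>H\<^esub> \<phi> z"
      using H.commutator_mult_central[OF _ _ x(2) y(2), of "\<phi> a" "\<phi> b"] x y wz c
        f.hom_commutator[of a b] by simp
    moreover have "\<phi> w \<in> ?A"
    proof -
      have "\<phi> w \<in> agemo p H (\<phi> ` carrier G)"
        using f.agemo_img[OF subset_refl, of p] wz(1) by blast
      then show ?thesis using H.agemo_mono[of "\<phi> ` carrier G" "carrier H" p] f.hom_closed by blast
    qed
    moreover have "\<phi> z \<in> ?A"
      using root wz(2) H.agemo_pow by metis
    ultimately show ?thesis using subgroup.m_closed[OF A] by simp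
  qed
  then have "comm_powerful p H" by (simp add: comm_powerful_def)
  then show thesis using that H by blast
qed

end

theorem theorem3:
  fixes G :: "('a, 'b) monoid_scheme" and p :: nat
  assumes "Factorial_Ring.prime p" and "odd p"
    and "p_group p G" and "quasi_powerful p G"
    and "x \<in> carrier G" and "y \<in> carrier G"
  shows "group.ord G (commutator G x y) \<le> group.ord G y"
proof -
  interpret odd_p_group G p
    using assms by (simp add: odd_p_group_def odd_p_group_axioms_def p_group_def)
  obtain H :: "nat monoid" and \<phi> where H: "central_overgroup p G H \<phi>" "comm_powerful p H"
    using powerful_central_overgroup[OF assms(4)] by blast
  interpret f: group_hom G H \<phi> using H by (simp add: central_overgroup_def)
  have "ord y dvd order G" using assms(6) by (rule ord_dvd_group_order)
  then obtain k where k: "ord y = p ^ k"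
    using order_pow divides_primepow_nat[OF prime_p] by auto
  then have "y [^]\<^bsub>G\<^esub> (p ^ k) = \<one>\<^bsub>G\<^esub>" using pow_ord_eq_1[OF assms(6)] by simp
  then have "\<phi> y [^]\<^bsub>H\<^esub> (p ^ k) = \<one>\<^bsub>H\<^esub>"
    using f.hom_nat_pow[OF assms(6), of "p ^ k"] by simp
  then have "commutator H (\<phi> x) (\<phi> y) [^]\<^bsub>H\<^esub> (p ^ k) = \<one>\<^bsub>H\<^esub>"
    using H assms(5,6) by (intro commutator_pow_eq_one) (simp_all add: central_overgroup_def)
  \<comment> \<open>Injectivity of \<phi> brings the relation back to \<open>G\<close>, where the
    order of the commutator then even divides that of \<open>y\<close>.\<close>
  then have "\<phi> (commutator G x y [^]\<^bsub>G\<^esub> (p ^ k)) = \<phi> \<one>\<^bsub>G\<^esub>"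
    using assms(5,6) by (simp add: f.hom_nat_pow f.hom_commutator)
  then have "commutator G x y [^]\<^bsub>G\<^esub> (p ^ k) = \<one>\<^bsub>G\<^esub>"
    using f.inj_on_one_iff H(1) assms(5,6) by (simp add: central_overgroup_def)
  then have "ord (commutator G x y) dvd p ^ k"
    using pow_eq_id assms(5,6) by simp
  then show ?thesis
    using k prime_p by (simp add: dvd_imp_le prime_gt_0_nat)
qed

end
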